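(* For every integer $t\ge 5$, there exists a $K_t$-minor-free graph that is not $\{1\star (t-3),2\}$-choosable.
   Context: All graphs are finite and simple. A graph is $K_t$-minor-free if $K_t$ (the complete graph on $t$ vertices) cannot be obtained from a subgraph of it by contracting edges. A list assignment $L$ of a graph $G$ assigns to each vertex $v$ a set $L(v)$ of colours; an $L$-colouring is a proper colouring $f$ with $f(v)\in L(v)$ for all $v$. For a multiset $\lambda=\{k_1,\dots,k_q\}$ of positive integers, a $\lambda$-list assignment of $G$ is a list assignment $L$ such that the colour set $\bigcup_{v\in V(G)}L(v)$ can be partitioned into $q$ sets $C_1,\dots,C_q$ with $|L(v)\cap C_i|\ge k_i$ for every $i$ and every vertex $v$. $G$ is $\lambda$-choosable if $G$ is $L$-colourable for every $\lambda$-list assignment $L$ of $G$. The notation $a\star m$ inside a multiset means $m$ copies of the integer $a$; thus $\{1\star(t-3),2\}$ consists of $t-3$ copies of $1$ and one copy of $2$. *)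

theory Defs
  imports Main "HOL-Library.Multiset"
begin

definition simple_graph :: "'a set \<Rightarrow> ('a \<Rightarrow> 'a \<Rightarrow> bool) \<Rightarrow> bool" where
  "simple_graph V E \<longleftrightarrow> finite V \<and> (\<forall>u v. E u v \<longrightarrow> u \<in> V \<and> v \<in> V)
     \<and> (\<forall>u v. E u v \<longrightarrow> E v u) \<and> (\<forall>v. \<not> E v v)"

inductive minor :: "'a set \<Rightarrow> ('a \<Rightarrow> 'a \<Rightarrow> bool) \<Rightarrow> 'a set \<Rightarrow> ('a \<Rightarrow> 'a \<Rightarrow> bool) \<Rightarrow> bool"
  for V E where
  refl: "minor V E V E"
| subgraph: "minor V E V' E' \<Longrightarrow> W \<subseteq> V' \<Longrightarrow>
      (\<forall>x y. F x y \<longrightarrow> E' x y \<and> x \<in> W \<and> y \<in> W) \<Longrightarrow> (\<forall>x y. F x y \<longrightarrow> F y x) \<Longrightarrow>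
      minor V E W F"
| contract: "minor V E V' E' \<Longrightarrow> E' u v \<Longrightarrow>
      minor V E (V' - {v})
        (\<lambda>x y. x \<in> V' - {v} \<and> y \<in> V' - {v} \<and> x \<noteq> y \<and>
               (E' x y \<or> (x = u \<and> E' v y) \<or> (y = u \<and> E' x v)))"

definition has_K_minor :: "'a set \<Rightarrow> ('a \<Rightarrow> 'a \<Rightarrow> bool) \<Rightarrow> nat \<Rightarrow> bool" where
  "has_K_minor V E t \<longleftrightarrow> (\<exists>W F. minor V E W F \<and> finite W \<and> card W = t \<and>
       (\<forall>x\<in>W. \<forall>y\<in>W. x \<noteq> y \<longrightarrow> F x y))"

definition K_minor_free :: "'a set \<Rightarrow> ('a \<Rightarrow> 'a \<Rightarrow> bool) \<Rightarrow> nat \<Rightarrow> bool" where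
  "K_minor_free V E t \<longleftrightarrow> \<not> has_K_minor V E t"

definition L_colouring :: "'a set \<Rightarrow> ('a \<Rightarrow> 'a \<Rightarrow> bool) \<Rightarrow> ('a \<Rightarrow> nat set) \<Rightarrow> ('a \<Rightarrow> nat) \<Rightarrow> bool" where
  "L_colouring V E L f \<longleftrightarrow> (\<forall>v\<in>V. f v \<in> L v) \<and> (\<forall>u\<in>V. \<forall>v\<in>V. E u v \<longrightarrow> f u \<noteq> f v)"

definition lambda_list_assignment :: "'a set \<Rightarrow> nat multiset \<Rightarrow> ('a \<Rightarrow> nat set) \<Rightarrow> bool" where
  "lambda_list_assignment V lam L \<longleftrightarrow>
     (\<exists>ks Cs. mset ks = lam \<and> length Cs = length ks \<and>
        (\<forall>i<length Cs. \<forall>j<length Cs. i \<noteq> j \<longrightarrow> Cs ! i \<inter> Cs ! j = {}) \<and>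
        \<Union>(set Cs) = (\<Union>v\<in>V. L v) \<and>
        (\<forall>i<length ks. \<forall>v\<in>V. card (L v \<inter> Cs ! i) \<ge> ks ! i))"

definition lambda_choosable :: "'a set \<Rightarrow> ('a \<Rightarrow> 'a \<Rightarrow> bool) \<Rightarrow> nat multiset \<Rightarrow> bool" where
  "lambda_choosable V E lam \<longleftrightarrow>
     (\<forall>L. lambda_list_assignment V lam L \<longrightarrow> (\<exists>f. L_colouring V E L f))"

end

theory Submission
  imports Defs
begin

text \<open>
  Fix \<open>k = t - 3\<close> colours that occur in every list (the classes of size one) and give each vertex two
  further colours from the remaining class. There is a planar triangulation on 16 vertices whose
  outer triangle cannot carry the colours \<open>1, 0, 2\<close> (one common colour, two private ones) when \<open>k = 2\<close>.
  Adding \<open>t - 5\<close> universal vertices coloured by the other common colours gives a \<open>K\<^sub>t\<close>-minor-free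
  graph in which a certain colouring of a clique of size \<open>t - 2\<close> does not extend. In \<open>K\<^bsub>t-1\<^esub>\<close> with all lists
  equal, every colouring shows this pattern on some ordered tuple of vertices, so gluing one copy of
  the gadget onto each such tuple leaves no colouring; clique-sums create no \<open>K\<^sub>t\<close>-minor.

  That a triangulated sphere has no \<open>K\<^sub>5\<close>-minor is seen from Euler's formula: spanning trees of the five
  branch sets together with ten connecting edges have at least seven faces, so some face is
  incident with at most two sides of the ten edges, and contracting the trees turns its boundary
  into a nonempty even subgraph of \<open>K\<^sub>5\<close> with at most two edges.
\<close>

section \<open>Models of complete graphs\<close>

text \<open>Connectedness by cuts instead of paths: the arguments below then only have to exhibit
  one edge leaving a given subset. The empty set counts as connected, so \<open>K_model\<close> asks
  for nonemptiness separately.\<close>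

definition connected_in :: "('a \<Rightarrow> 'a \<Rightarrow> bool) \<Rightarrow> 'a set \<Rightarrow> bool" where
  "connected_in E B \<longleftrightarrow> (\<forall>A\<subseteq>B. A \<noteq> {} \<longrightarrow> A \<noteq> B \<longrightarrow> (\<exists>x\<in>A. \<exists>y\<in>B - A. E x y))"

definition K_model :: "'a set \<Rightarrow> ('a \<Rightarrow> 'a \<Rightarrow> bool) \<Rightarrow> 'a set set \<Rightarrow> bool" where
  "K_model V E \<B> \<longleftrightarrow>
     (\<forall>B\<in>\<B>. B \<noteq> {} \<and> B \<subseteq> V \<and> connected_in E B) \<and>
     (\<forall>B\<in>\<B>. \<forall>C\<in>\<B>. B \<noteq> C \<longrightarrow> B \<inter> C = {} \<and> (\<exists>x\<in>B. \<exists>y\<in>C. E x y))"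

definition K_model_free :: "'a set \<Rightarrow> ('a \<Rightarrow> 'a \<Rightarrow> bool) \<Rightarrow> nat \<Rightarrow> bool" where
  "K_model_free V E t \<longleftrightarrow> (\<forall>\<B>. K_model V E \<B> \<longrightarrow> card \<B> \<noteq> t)"

lemma connected_inD:
  assumes "connected_in E B" "A \<subseteq> B" "A \<noteq> {}" "A \<noteq> B"
  obtains x y where "x \<in> A" "y \<in> B" "y \<notin> A" "E x y"
  using assms unfolding connected_in_def by blast

lemma connected_in_singleton: "connected_in E {x}"
  unfolding connected_in_def by (auto simp: subset_singleton_iff)

text \<open>A cut of the union either splits one of the two parts or separates them. In the second
  case the edge \<open>x y\<close> crosses the cut, in one direction or the other, hence the
  symmetry of \<open>E\<close>.\<close>

lemma connected_in_Un:
  assumes "connected_in E B" "connected_in E C" "symp E" "x \<in> B" "y \<in> C" "E x y"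
  shows "connected_in E (B \<union> C)"
  unfolding connected_in_def
proof (intro allI impI)
  fix A assume A: "A \<subseteq> B \<union> C" "A \<noteq> {}" "A \<noteq> B \<union> C"
  have "E y x" using assms(3,6) by (rule sympD)
  show "\<exists>x\<in>A. \<exists>y\<in>B \<union> C - A. E x y"
  proof (cases "A \<inter> B = {} \<or> B \<subseteq> A")
    case False
    then obtain p q where "p \<in> A \<inter> B" "q \<in> B" "q \<notin> A \<inter> B" "E p q"
      using connected_inD[OF assms(1), of "A \<inter> B"] by blast
    then show ?thesis by blast
  next
    case B: True
    show ?thesis
    proof (cases "A \<inter> C = {} \<or> C \<subseteq> A")
      case False
      then obtain p q where "p \<in> A \<inter> C" "q \<in> C" "q \<notin> A \<inter> C" "E p q"
        using connected_inD[OF assms(2), of "A \<inter> C"] by blast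
      then show ?thesis by blast
    next
      case True
      with B A \<open>x \<in> B\<close> \<open>y \<in> C\<close> \<open>E x y\<close> \<open>E y x\<close> show ?thesis by blast
    qed
  qed
qed

lemma K_model_disjoint: "K_model V E \<B> \<Longrightarrow> B \<in> \<B> \<Longrightarrow> C \<in> \<B> \<Longrightarrow> x \<in> B \<Longrightarrow> x \<in> C \<Longrightarrow> B = C"
  unfolding K_model_def by blast

lemma K_modelD:
  assumes "K_model V E \<B>" "B \<in> \<B>"
  shows "B \<noteq> {}" "B \<subseteq> V" "connected_in E B"
  using assms by (simp_all add: K_model_def)

lemma K_model_adjacent:
  assumes "K_model V E \<B>" "B \<in> \<B>" "C \<in> \<B>" "B \<noteq> C"
  obtains x y where "x \<in> B" "y \<in> C" "E x y"
proof -
  have "\<exists>x\<in>B. \<exists>y\<in>C. E x y" using assms by (simp add: K_model_def)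
  then show thesis using that by blast
qed

lemma K_model_card_le:
  assumes "K_model V E \<B>" "finite V"
  shows "finite \<B>" "card \<B> \<le> card V"
proof -
  define r where "r B = (SOME x. x \<in> B)" for B :: "'a set"
  have r: "r B \<in> B" if "B \<in> \<B>" for B
    unfolding r_def using K_modelD(1)[OF assms(1) that] by (simp add: some_in_eq)
  have "inj_on r \<B>"
  proof (rule inj_onI)
    fix B C assume "B \<in> \<B>" "C \<in> \<B>" "r B = r C"
    then show "B = C" using K_model_disjoint[OF assms(1), of B C "r B"] r[of B] r[of C] by simp
  qed
  moreover have "r ` \<B> \<subseteq> V" using r K_modelD(2)[OF assms(1)] by blast
  ultimately show "finite \<B>" "card \<B> \<le> card V"
    using assms(2) by (auto intro: inj_on_finite card_inj_on_le)
qed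

section \<open>From minors to branch sets\<close>

text \<open>Induction over the formation of the minor: every surviving vertex carries a set of
  original vertices. Contracting \<open>v\<close> into \<open>u\<close> merges their two sets, and
  passing to a subgraph restricts the family.\<close>

lemma minor_branch_sets:
  assumes "minor V E W F" "simple_graph V E"
  shows "symp F \<and> (\<forall>x y. F x y \<longrightarrow> x \<in> W \<and> y \<in> W) \<and>
         (\<exists>b. (\<forall>x\<in>W. b x \<noteq> {} \<and> b x \<subseteq> V \<and> connected_in E (b x)) \<and>
           (\<forall>x\<in>W. \<forall>y\<in>W. x \<noteq> y \<longrightarrow> b x \<inter> b y = {}) \<and>
           (\<forall>x\<in>W. \<forall>y\<in>W. x \<noteq> y \<longrightarrow> F x y \<longrightarrow> (\<exists>p\<in>b x. \<exists>q\<in>b y. E p q)))"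
  using assms(1)
proof induction
  case refl
  show ?case using assms(2)
    by (auto intro!: exI[of _ "\<lambda>x. {x}"] connected_in_singleton sympI simp: simple_graph_def)
next
  case (subgraph V' E' W F)
  from subgraph.IH obtain b where b: "\<forall>x\<in>V'. b x \<noteq> {} \<and> b x \<subseteq> V \<and> connected_in E (b x)"
      "\<forall>x\<in>V'. \<forall>y\<in>V'. x \<noteq> y \<longrightarrow> b x \<inter> b y = {}"
      "\<forall>x\<in>V'. \<forall>y\<in>V'. x \<noteq> y \<longrightarrow> E' x y \<longrightarrow> (\<exists>p\<in>b x. \<exists>q\<in>b y. E p q)" by blast
  show ?case
  proof (intro conjI exI[of _ b])
    show "symp F" using subgraph.hyps(4) by (simp add: symp_def)
    show "\<forall>x y. F x y \<longrightarrow> x \<in> W \<and> y \<in> W" using subgraph.hyps(3) by simp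
    show "\<forall>x\<in>W. b x \<noteq> {} \<and> b x \<subseteq> V \<and> connected_in E (b x)"
      using b(1) subgraph.hyps(2) by blast
    show "\<forall>x\<in>W. \<forall>y\<in>W. x \<noteq> y \<longrightarrow> b x \<inter> b y = {}"
      using b(2) subgraph.hyps(2) by (meson subsetD)
    show "\<forall>x\<in>W. \<forall>y\<in>W. x \<noteq> y \<longrightarrow> F x y \<longrightarrow> (\<exists>p\<in>b x. \<exists>q\<in>b y. E p q)"
      using b(3) subgraph.hyps(2,3) by (meson subsetD)
  qed
next
  case (contract V' E' u v)
  from contract.IH have "symp E'" and V': "\<And>x y. E' x y \<Longrightarrow> x \<in> V' \<and> y \<in> V'" by simp_all
  from contract.IH obtain b where *: "\<forall>x\<in>V'. b x \<noteq> {} \<and> b x \<subseteq> V \<and> connected_in E (b x)"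
      "\<forall>x\<in>V'. \<forall>y\<in>V'. x \<noteq> y \<longrightarrow> b x \<inter> b y = {}"
      "\<forall>x\<in>V'. \<forall>y\<in>V'. x \<noteq> y \<longrightarrow> E' x y \<longrightarrow> (\<exists>p\<in>b x. \<exists>q\<in>b y. E p q)" by blast
  have b: "\<And>x. x \<in> V' \<Longrightarrow> b x \<noteq> {} \<and> b x \<subseteq> V \<and> connected_in E (b x)"
    and disj: "\<And>x y. x \<in> V' \<Longrightarrow> y \<in> V' \<Longrightarrow> x \<noteq> y \<Longrightarrow> b x \<inter> b y = {}"
    and adj: "\<And>x y. x \<in> V' \<Longrightarrow> y \<in> V' \<Longrightarrow> x \<noteq> y \<Longrightarrow> E' x y \<Longrightarrow> \<exists>p\<in>b x. \<exists>q\<in>b y. E p q"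
    using * by simp_all
  have "symp E" using assms(2) by (auto intro: sympI simp: simple_graph_def)
  have uv: "u \<in> V'" "v \<in> V'" using contract.hyps V' by blast+
  have conn: "connected_in E (b u \<union> b v)"
  \<comment> \<open>The invariant does not record that \<open>E'\<close> is loop-free, so a
    contraction with \<open>u = v\<close> is a case of its own; the union is then a single branch
    set.\<close>
  proof (cases "u = v")
    case False
    then obtain p q where "p \<in> b u" "q \<in> b v" "E p q" using adj[of u v] uv contract.hyps by blast
    then show ?thesis using b[OF uv(1)] b[OF uv(2)] connected_in_Un[OF _ _ \<open>symp E\<close>] by simp
  qed (use b uv in auto)
  define b' where "b' = b(u := b u \<union> b v)"
  show ?case
  proof (intro conjI exI[of _ b'] ballI impI)
    fix x y assume xy: "x \<in> V' - {v}" "y \<in> V' - {v}" "x \<noteq> y"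
    show "b' x \<inter> b' y = {}"
      using xy disj[of x y] disj[of x v] disj[of v y] uv
      by (auto simp: b'_def Int_Un_distrib Int_Un_distrib2)
    assume e: "x \<in> V' - {v} \<and> y \<in> V' - {v} \<and> x \<noteq> y \<and> (E' x y \<or> (x = u \<and> E' v y) \<or> (y = u \<and> E' x v))"
    have sub: "b z \<subseteq> b' z" for z unfolding b'_def by auto
    from e consider "E' x y" | "x = u" "E' v y" | "y = u" "E' x v" by blast
    then obtain p q where "p \<in> b' x" "q \<in> b' y" "E p q"
    proof cases
      case 1
      then obtain p q where "p \<in> b x" "q \<in> b y" "E p q" using adj[of x y] xy by blast
      then show ?thesis using that sub by blast
    next
      case 2
      then obtain p q where "p \<in> b v" "q \<in> b y" "E p q" using adj[of v y] xy uv by blast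
      moreover from this have "p \<in> b' x" using 2 by (simp add: b'_def)
      ultimately show ?thesis using that sub by blast
    next
      case 3
      then obtain p q where "p \<in> b x" "q \<in> b v" "E p q" using adj[of x v] xy uv by blast
      moreover from this have "q \<in> b' y" using 3 by (simp add: b'_def)
      ultimately show ?thesis using that sub by blast
    qed
    then show "\<exists>p\<in>b' x. \<exists>q\<in>b' y. E p q" by blast
  next
    show "symp (\<lambda>x y. x \<in> V' - {v} \<and> y \<in> V' - {v} \<and> x \<noteq> y \<and>
        (E' x y \<or> (x = u \<and> E' v y) \<or> (y = u \<and> E' x v)))"
      using \<open>symp E'\<close> by (auto intro!: sympI dest: sympD)
  next
    fix x assume "x \<in> V' - {v}"
    then show "b' x \<noteq> {}" "b' x \<subseteq> V" "connected_in E (b' x)"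
      using b[of x] b[OF uv(2)] conn by (auto simp: b'_def)
  qed auto
qed

text \<open>The branch sets of a complete minor on \<open>t\<close> vertices form a model with
  \<open>t\<close> members. From here on it is enough to exclude models.\<close>

lemma K_minor_free_if_K_model_free:
  assumes "simple_graph V E" "K_model_free V E t"
  shows "K_minor_free V E t"
  unfolding K_minor_free_def has_K_minor_def
proof safe
  fix W F assume W: "minor V E W F" "finite W" "t = card W" "\<forall>x\<in>W. \<forall>y\<in>W. x \<noteq> y \<longrightarrow> F x y"
  from minor_branch_sets[OF W(1) assms(1)] obtain b where
      b: "\<And>x. x \<in> W \<Longrightarrow> b x \<noteq> {} \<and> b x \<subseteq> V \<and> connected_in E (b x)"
      and disj: "\<And>x y. x \<in> W \<Longrightarrow> y \<in> W \<Longrightarrow> x \<noteq> y \<Longrightarrow> b x \<inter> b y = {}"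
      and adj: "\<And>x y. x \<in> W \<Longrightarrow> y \<in> W \<Longrightarrow> x \<noteq> y \<Longrightarrow> \<exists>p\<in>b x. \<exists>q\<in>b y. E p q"
    using W(4) by metis
  have "K_model V E (b ` W)"
    unfolding K_model_def
  proof (intro conjI ballI impI)
    fix B C assume "B \<in> b ` W" "C \<in> b ` W" "B \<noteq> C"
    then obtain x y where "x \<in> W" "y \<in> W" "x \<noteq> y" "B = b x" "C = b y" by blast
    then show "B \<inter> C = {}" "\<exists>x\<in>B. \<exists>y\<in>C. E x y" using disj adj by auto
  qed (use b in auto)
  moreover have "inj_on b W" using b disj by (metis Int_absorb inj_onI)
  ultimately show False using assms(2) W(3) card_image unfolding K_model_free_def by blast
qed

section \<open>Models under added vertices and clique sums\<close>

lemma K_model_free_if_card_less: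
  assumes "finite V" "card V < t"
  shows "K_model_free V E t"
  using assms K_model_card_le unfolding K_model_free_def by (metis leD)

text \<open>At most one branch set contains \<open>w\<close>. Discarding it, or any one set if there
  is none, leaves a model inside \<open>V\<close> with one member fewer.\<close>

lemma K_model_free_universal_vertex:
  assumes "K_model_free V E t" "w \<notin> V" "\<And>x y. x \<noteq> w \<Longrightarrow> y \<noteq> w \<Longrightarrow> E' x y = E x y"
  shows "K_model_free (insert w V) E' (Suc t)"
  unfolding K_model_free_def
proof safe
  fix \<B> assume \<B>: "K_model (insert w V) E' \<B>" "card \<B> = Suc t"
  have "\<exists>B\<in>\<B>. \<forall>C\<in>\<B> - {B}. w \<notin> C"
  proof (cases "\<exists>B\<in>\<B>. w \<in> B")
    case True then show ?thesis using K_model_disjoint[OF \<B>(1)] by blast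
  next
    case False
    moreover have "\<B> \<noteq> {}" using \<B>(2) by auto
    ultimately show ?thesis by blast
  qed
  then obtain B where B: "B \<in> \<B>" "\<And>C. C \<in> \<B> - {B} \<Longrightarrow> w \<notin> C" by blast
  have conn: "connected_in E C" if "connected_in E' C" "w \<notin> C" for C
    unfolding connected_in_def
  proof (intro allI impI)
    fix A assume "A \<subseteq> C" "A \<noteq> {}" "A \<noteq> C"
    with connected_inD[OF that(1)] obtain x y where "x \<in> A" "y \<in> C" "y \<notin> A" "E' x y" by metis
    with \<open>A \<subseteq> C\<close> that(2) assms(3)[of x y] show "\<exists>x\<in>A. \<exists>y\<in>C - A. E x y" by blast
  qed
  have "K_model V E (\<B> - {B})"
    unfolding K_model_def
  proof (intro conjI ballI impI)
    fix C assume C: "C \<in> \<B> - {B}"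
    then show "C \<noteq> {}" "C \<subseteq> V" "connected_in E C"
      using K_modelD[OF \<B>(1), of C] B(2)[OF C] conn[of C] by auto
    fix D assume D: "D \<in> \<B> - {B}" "C \<noteq> D"
    then show "C \<inter> D = {}" using K_model_disjoint[OF \<B>(1)] C by blast
    obtain x y where "x \<in> C" "y \<in> D" "E' x y" using K_model_adjacent[OF \<B>(1)] C D by blast
    then show "\<exists>x\<in>C. \<exists>y\<in>D. E x y" using B(2) C D assms(3) by metis
  qed
  moreover have "card (\<B> - {B}) = t" using \<B>(2) B(1) by simp
  ultimately show False using assms(1) unfolding K_model_free_def by blast
qed

text \<open>A branch set that leaves \<open>V1\<close> can return only through
  \<open>V1 \<inter> V2\<close>. This is a clique of \<open>E1\<close>, whose edges replace all
  detours through \<open>V2\<close>, so the traces on \<open>V1\<close> remain connected and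
  pairwise adjacent.\<close>

lemma K_model_restrict_clique_sum:
  assumes "K_model (V1 \<union> V2) (\<lambda>u v. E1 u v \<or> E2 u v) \<B>"
    and G1: "simple_graph V1 E1" and G2: "simple_graph V2 E2"
    and clique: "\<And>x y. x \<in> V1 \<inter> V2 \<Longrightarrow> y \<in> V1 \<inter> V2 \<Longrightarrow> x \<noteq> y \<Longrightarrow> E1 x y"
    and meet: "\<And>B. B \<in> \<B> \<Longrightarrow> B \<inter> V1 \<noteq> {}"
  shows "K_model V1 E1 ((\<lambda>B. B \<inter> V1) ` \<B>)" "inj_on (\<lambda>B. B \<inter> V1) \<B>"
proof -
  let ?E = "\<lambda>u v. E1 u v \<or> E2 u v"
  have E1: "E1 x y" if "?E x y" "x \<in> V1" "y \<in> V1" for x y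
    using that G2 clique unfolding simple_graph_def by (metis IntI)
  have cross: "x \<in> V2" "y \<in> V2" if "?E x y" "x \<notin> V1 \<or> y \<notin> V1" for x y
    using that G1 G2 unfolding simple_graph_def by blast+
  have conn: "connected_in E1 (B \<inter> V1)" if B: "B \<in> \<B>" for B
    unfolding connected_in_def
  proof (intro allI impI)
    fix A assume A: "A \<subseteq> B \<inter> V1" "A \<noteq> {}" "A \<noteq> B \<inter> V1"
    have cB: "connected_in ?E B" using K_modelD(3)[OF assms(1) B] .
    show "\<exists>x\<in>A. \<exists>y\<in>B \<inter> V1 - A. E1 x y"
    proof (cases "A \<inter> V2 = {}")
      case True
      have "A \<subseteq> B" "A \<noteq> B" using A by blast+
      then obtain x y where xy: "x \<in> A" "y \<in> B" "y \<notin> A" "?E x y"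
        using connected_inD[OF cB _ A(2)] by metis
      then have "y \<in> V1" using cross(1)[of x y] True by blast
      then show ?thesis using xy A E1[of x y] by blast
    next
      case False
      show ?thesis
      proof (cases "B \<inter> V1 \<inter> V2 \<subseteq> A")
        case False
        then obtain x y where "x \<in> A \<inter> V2" "y \<in> B \<inter> V1 \<inter> V2" "y \<notin> A"
          using \<open>A \<inter> V2 \<noteq> {}\<close> by blast
        moreover from this have "E1 x y" using A by (intro clique) auto
        ultimately show ?thesis by blast
      next
        case S: True
        \<comment> \<open>\<open>A\<close> holds all attachment vertices of \<open>B\<close>, so
          \<open>B - V1\<close> is added to it: an edge leaving the enlarged set cannot start
          outside \<open>V1\<close>, since its other end would be an attachment vertex outside
          \<open>A\<close>.\<close>
        have "A \<union> (B - V1) \<subseteq> B" "A \<union> (B - V1) \<noteq> {}" "A \<union> (B - V1) \<noteq> B" using A by blast+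
        then obtain x y where xy: "x \<in> A \<union> (B - V1)" "y \<in> B" "y \<notin> A \<union> (B - V1)" "?E x y"
          using connected_inD[OF cB] by metis
        then have "x \<in> V1" using cross(2)[of x y] S by blast
        then show ?thesis using xy A E1[of x y] by blast
      qed
    qed
  qed
  have adj: "\<exists>x\<in>B \<inter> V1. \<exists>y\<in>C \<inter> V1. E1 x y" if BC: "B \<in> \<B>" "C \<in> \<B>" "B \<noteq> C" for B C
  proof -
    have disj: "B \<inter> C = {}" using K_model_disjoint[OF assms(1)] BC by blast
    obtain x y where xy: "x \<in> B" "y \<in> C" "?E x y"
      using K_model_adjacent[OF assms(1) BC] .
    \<comment> \<open>An edge from \<open>D \<inter> V1\<close> to the rest of \<open>D\<close> has
      both ends in \<open>V2\<close>, so a branch set that reaches \<open>V2\<close> contains a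
      vertex of the common clique.\<close>
    have meet2: "\<exists>z\<in>D. z \<in> V1 \<inter> V2" if D: "D \<in> \<B>" "z \<in> D" "z \<in> V2" for D z
    proof (cases "D \<inter> V1 = D")
      case True then show ?thesis using D by blast
    next
      case False
      have cD: "connected_in ?E D" using K_modelD(3)[OF assms(1) D(1)] .
      obtain p q where "p \<in> D \<inter> V1" "q \<in> D" "q \<notin> D \<inter> V1" "?E p q"
        using connected_inD[OF cD _ meet[OF D(1)] False] by blast
      then show ?thesis using cross(1)[of p q] by blast
    qed
    show ?thesis
    proof (cases "x \<in> V1 \<and> y \<in> V1")
      case True then show ?thesis using xy E1 by blast
    next
      case False
      then have "x \<in> V2" "y \<in> V2" using cross xy by blast+
      then obtain x' y' where "x' \<in> B" "x' \<in> V1 \<inter> V2" "y' \<in> C" "y' \<in> V1 \<inter> V2"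
        using meet2 BC xy by meson
      then show ?thesis using clique[of x' y'] disj by blast
    qed
  qed
  show "inj_on (\<lambda>B. B \<inter> V1) \<B>"
    using meet K_model_disjoint[OF assms(1)] by (intro inj_onI) (metis IntE ex_in_conv)
  show "K_model V1 E1 ((\<lambda>B. B \<inter> V1) ` \<B>)"
    unfolding K_model_def
  proof (intro conjI ballI impI)
    fix B' C' assume "B' \<in> (\<lambda>B. B \<inter> V1) ` \<B>" "C' \<in> (\<lambda>B. B \<inter> V1) ` \<B>" "B' \<noteq> C'"
    then obtain B C where BC: "B \<in> \<B>" "C \<in> \<B>" "B \<noteq> C" "B' = B \<inter> V1" "C' = C \<inter> V1" by blast
    then show "B' \<inter> C' = {}" using K_model_disjoint[OF assms(1)] by blast
    show "\<exists>x\<in>B'. \<exists>y\<in>C'. E1 x y" using adj BC by simp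
  next
    fix B' assume "B' \<in> (\<lambda>B. B \<inter> V1) ` \<B>"
    then obtain B where "B \<in> \<B>" "B' = B \<inter> V1" by blast
    then show "B' \<noteq> {}" "B' \<subseteq> V1" "connected_in E1 B'" using meet conn by simp_all
  qed
qed

text \<open>If some branch set misses \<open>V1\<close>, every other one sends an edge to it, and
  that edge must come from \<open>E2\<close>. Hence all branch sets meet \<open>V1\<close> or all
  meet \<open>V2\<close>, and the model restricts to that side.\<close>

lemma K_model_free_clique_sum:
  assumes G1: "simple_graph V1 E1" and G2: "simple_graph V2 E2"
    and free: "K_model_free V1 E1 t" "K_model_free V2 E2 t"
    and clique: "\<And>x y. x \<in> V1 \<inter> V2 \<Longrightarrow> y \<in> V1 \<inter> V2 \<Longrightarrow> x \<noteq> y \<Longrightarrow> E1 x y \<and> E2 x y"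
  shows "K_model_free (V1 \<union> V2) (\<lambda>u v. E1 u v \<or> E2 u v) t"
  unfolding K_model_free_def
proof (intro allI impI notI)
  let ?E = "\<lambda>u v. E1 u v \<or> E2 u v"
  fix \<B> assume \<B>: "K_model (V1 \<union> V2) ?E \<B>" and t: "card \<B> = t"
  have clique1: "E1 x y" if "x \<in> V1 \<inter> V2" "y \<in> V1 \<inter> V2" "x \<noteq> y" for x y
    using clique[OF that] ..
  have clique2: "E2 x y" if "x \<in> V2 \<inter> V1" "y \<in> V2 \<inter> V1" "x \<noteq> y" for x y
    using clique[of x y] that by simp
  show False
  proof (cases "\<forall>B\<in>\<B>. B \<inter> V1 \<noteq> {}")
    case True
    then have meet: "B \<inter> V1 \<noteq> {}" if "B \<in> \<B>" for B using that by blast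
    note * = K_model_restrict_clique_sum[OF \<B> G1 G2 clique1 meet]
    show False using free(1) *(1) t card_image[OF *(2)] unfolding K_model_free_def by metis
  next
    case False
    then obtain C where C: "C \<in> \<B>" "C \<inter> V1 = {}" by blast
    have meet: "B \<inter> V2 \<noteq> {}" if B: "B \<in> \<B>" for B
    proof (cases "B = C")
      case True then show ?thesis using C(2) K_modelD(1,2)[OF \<B> C(1)] by blast
    next
      case False
      obtain x y where "x \<in> B" "y \<in> C" "E1 x y \<or> E2 x y"
        using K_model_adjacent[OF \<B> B C(1) False] .
      moreover have "\<not> E1 x y" using G1 C(2) \<open>y \<in> C\<close> unfolding simple_graph_def by blast
      ultimately have "x \<in> V2" using G2 unfolding simple_graph_def by blast
      then show ?thesis using \<open>x \<in> B\<close> by blast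
    qed
    have \<B>': "K_model (V2 \<union> V1) (\<lambda>u v. E2 u v \<or> E1 u v) \<B>"
      using \<B> by (simp add: Un_commute disj_commute)
    note * = K_model_restrict_clique_sum[OF \<B>' G2 G1 clique2 meet]
    show False using free(2) *(1) t card_image[OF *(2)] unfolding K_model_free_def by metis
  qed
qed

section \<open>Triangulated spheres have no \<open>K\<^sub>5\<close>-minor\<close>

definition edges :: "('a \<Rightarrow> 'a \<Rightarrow> bool) \<Rightarrow> 'a set set" where
  "edges E = {{u,v} |u v. E u v}"

text \<open>Elements of the cycle space over the field with two elements, given as edge
  sets.\<close>

definition even_subgraph :: "'a set set \<Rightarrow> bool" where
  "even_subgraph Z \<longleftrightarrow> (\<forall>v. even (card {e\<in>Z. v \<in> e}))"

text \<open>Acyclicity is stated as the absence of nonempty even edge sets. The tree grows leaf by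
  leaf: the new edge is the only one at the new vertex, so no even set contains it.\<close>

lemma connected_in_spanning_tree:
  assumes "connected_in E B" "finite B" "B \<noteq> {}"
  shows "\<exists>T. T \<subseteq> edges E \<inter> Pow B \<and> Suc (card T) = card B \<and>
           (\<forall>Z\<subseteq>T. even_subgraph Z \<longrightarrow> Z = {})"
proof -
  define tree where "tree A T \<longleftrightarrow> T \<subseteq> edges E \<inter> Pow A \<and> Suc (card T) = card A \<and>
           (\<forall>Z\<subseteq>T. even_subgraph Z \<longrightarrow> Z = {})" for A T
  have grow: "\<exists>A T. A \<subseteq> B \<and> card A = Suc k \<and> tree A T" if "k < card B" for k
    using that
  proof (induction k)
    case 0
    obtain x where "x \<in> B" using assms(3) by blast
    then show ?case by (intro exI[of _ "{x}"] exI[of _ "{}"]) (auto simp: tree_def)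
  next
    case (Suc k)
    then obtain A T where A: "A \<subseteq> B" "card A = Suc k" and T: "tree A T" by (meson Suc_lessD)
    have fin: "finite A" using A(1) assms(2) finite_subset by blast
    have "A \<noteq> {}" "A \<noteq> B" using A(2) Suc.prems by auto
    then obtain x y where xy: "x \<in> A" "y \<in> B" "y \<notin> A" "E x y"
      using connected_inD[OF assms(1) A(1)] by metis
    have TA: "\<Union>T \<subseteq> A" using T unfolding tree_def by auto
    have "finite T" using TA fin finite_UnionD finite_subset by blast
    have new: "{x,y} \<notin> T" using TA xy(3) by auto
    have "tree (insert y A) (insert {x,y} T)"
      unfolding tree_def
    proof (intro conjI allI impI)
      have "{x,y} \<in> edges E" using xy(4) unfolding edges_def by blast
      then show "insert {x,y} T \<subseteq> edges E \<inter> Pow (insert y A)"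
        using T xy(1) unfolding tree_def by auto
      show "Suc (card (insert {x,y} T)) = card (insert y A)"
        using T new \<open>finite T\<close> fin xy(3) by (simp add: tree_def)
      fix Z assume Z: "Z \<subseteq> insert {x,y} T" "even_subgraph Z"
      have "{x,y} \<notin> Z"
      proof
        assume "{x,y} \<in> Z"
        then have "{e\<in>Z. y \<in> e} = {{x,y}}" using Z(1) TA xy(3) by auto
        then have "odd (card {e\<in>Z. y \<in> e})" by simp
        then show False using Z(2) unfolding even_subgraph_def by blast
      qed
      then show "Z = {}" using T Z by (simp add: subset_insert tree_def)
    qed
    moreover have "card (insert y A) = Suc (Suc k)" using fin xy(3) A(2) by simp
    moreover have "insert y A \<subseteq> B" using A(1) xy(2) by blast
    ultimately show ?case by blast
  qed
  have "card B - 1 < card B" "Suc (card B - 1) = card B"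
    using assms by (simp_all add: card_gt_0_iff)
  from grow[OF this(1)] this(2) obtain A T where "A \<subseteq> B" "card A = card B" and T: "tree A T"
    by metis
  then have "A = B" using card_subset_eq[OF assms(2)] by simp
  with T show ?thesis by (intro exI[of _ T]) (simp add: tree_def)
qed

text \<open>As long as the branch sets do not cover \<open>V\<close>, an edge leaves their union,
  and its outer end is absorbed into the branch set at its inner end.\<close>

lemma K_model_extend_spanning:
  assumes "K_model V E \<B>" "connected_in E V" "finite V" "\<B> \<noteq> {}" "symp E"
  shows "\<exists>\<B>'. K_model V E \<B>' \<and> card \<B>' = card \<B> \<and> \<Union>\<B>' = V"
  using assms(1,4)
proof (induction "card (V - \<Union>\<B>)" arbitrary: \<B> rule: less_induct)
  case less
  show ?case
  proof (cases "\<Union>\<B> = V")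
    case True then show ?thesis using less.prems by blast
  next
    case False
    have sub: "\<Union>\<B> \<subseteq> V" and ne: "\<Union>\<B> \<noteq> {}"
      using K_modelD(1,2)[OF less.prems(1)] less.prems(2) by blast+
    obtain x y where xy: "x \<in> \<Union>\<B>" "y \<in> V" "y \<notin> \<Union>\<B>" "E x y"
      using connected_inD[OF assms(2) sub ne False] .
    then obtain B where B: "B \<in> \<B>" "x \<in> B" by blast
    have fin: "finite \<B>" using K_model_card_le(1)[OF less.prems(1) assms(3)] .
    define \<B>' where "\<B>' = insert (insert y B) (\<B> - {B})"
    have nB: "insert y B \<notin> \<B>" using xy(3) by blast
    have card: "card \<B>' = card \<B>" unfolding \<B>'_def using fin nB card_Suc_Diff1[OF fin B(1)] by simp
    have "connected_in E (insert y B)"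
      using connected_in_Un[OF K_modelD(3)[OF less.prems(1) B(1)] connected_in_singleton assms(5) B(2) _ xy(4)]
      by simp
    have adj: "\<exists>p\<in>insert y B. \<exists>q\<in>C. E p q" "\<exists>q\<in>C. \<exists>p\<in>insert y B. E q p" "insert y B \<inter> C = {}"
      if C: "C \<in> \<B>" "C \<noteq> B" for C
    proof -
      obtain p q where "p \<in> B" "q \<in> C" "E p q" using K_model_adjacent[OF less.prems(1) B(1) C(1)] C(2) by metis
      moreover from this have "E q p" using assms(5) by (meson sympD)
      ultimately show "\<exists>p\<in>insert y B. \<exists>q\<in>C. E p q" "\<exists>q\<in>C. \<exists>p\<in>insert y B. E q p" by blast+
      show "insert y B \<inter> C = {}" using K_model_disjoint[OF less.prems(1) B(1) C(1)] C xy(3) by blast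
    qed
    have "K_model V E \<B>'"
      unfolding K_model_def
    proof (intro conjI ballI impI)
      fix C assume "C \<in> \<B>'"
      then have "C = insert y B \<or> C \<in> \<B>" unfolding \<B>'_def by blast
      then show "C \<noteq> {}" "C \<subseteq> V" "connected_in E C"
        using K_modelD[OF less.prems(1)] B(1) xy(2) \<open>connected_in E (insert y B)\<close> by auto
    next
      fix C D assume "C \<in> \<B>'" "D \<in> \<B>'" "C \<noteq> D"
      then consider "C = insert y B" "D \<in> \<B>" "D \<noteq> B" | "D = insert y B" "C \<in> \<B>" "C \<noteq> B"
        | "C \<in> \<B>" "D \<in> \<B>" unfolding \<B>'_def by blast
      then show "C \<inter> D = {}" "\<exists>p\<in>C. \<exists>q\<in>D. E p q"
      proof (atomize (full), cases)
        case 1 then show "C \<inter> D = {} \<and> (\<exists>p\<in>C. \<exists>q\<in>D. E p q)" using adj by simp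
      next
        case 2 then show "C \<inter> D = {} \<and> (\<exists>p\<in>C. \<exists>q\<in>D. E p q)" using adj by (metis Int_commute)
      next
        case 3 then show "C \<inter> D = {} \<and> (\<exists>p\<in>C. \<exists>q\<in>D. E p q)"
          using less.prems(1) \<open>C \<noteq> D\<close> unfolding K_model_def by simp
      qed
    qed
    moreover have "card (V - \<Union>\<B>') < card (V - \<Union>\<B>)"
    proof (rule psubset_card_mono)
      show "finite (V - \<Union>\<B>)" using assms(3) by simp
      have "\<Union>\<B>' = insert y (\<Union>\<B>)" unfolding \<B>'_def using B(1) by blast
      then show "V - \<Union>\<B>' \<subset> V - \<Union>\<B>" using xy by blast
    qed
    moreover have "\<B>' \<noteq> {}" unfolding \<B>'_def by blast
    ultimately show ?thesis using less.hyps[of \<B>'] card by auto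
  qed
qed

text \<open>Lower bound on the number of components of a graph with vertex set \<open>F\<close> and
  edges \<open>p y\<close>, \<open>q y\<close>: each identification loses at most one label.\<close>

lemma merge_classes:
  fixes F :: "'f set"
  assumes "finite F" "finite Y"
  shows "\<exists>c :: 'f \<Rightarrow> 'f. card F \<le> card (c ` F) + card Y \<and> (\<forall>y\<in>Y. c (p y) = c (q y))"
  using assms(2)
proof induction
  case empty
  show ?case by (intro exI[of _ id]) simp
next
  case (insert y Y)
  then obtain c :: "'f \<Rightarrow> 'f" where c: "card F \<le> card (c ` F) + card Y" "\<forall>y\<in>Y. c (p y) = c (q y)" by blast
  define c' where "c' x = (if c x = c (p y) then c (q y) else c x)" for x
  have "c ` F - {c (p y)} \<subseteq> c' ` F" unfolding c'_def by auto
  then have "card (c ` F - {c (p y)}) \<le> card (c' ` F)"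
    using assms(1) by (simp add: card_mono)
  then have "card (c ` F) \<le> Suc (card (c' ` F))" by (simp add: card_Diff_singleton_if split: if_splits)
  then have "card F \<le> card (c' ` F) + card (insert y Y)" using c(1) insert.hyps by simp
  moreover have "\<forall>z\<in>insert y Y. c' (p z) = c' (q z)" using c(2) unfolding c'_def by auto
  ultimately show ?case by blast
qed

lemma card_edge:
  assumes "simple_graph V E" "e \<in> edges E"
  shows "card e = 2"
proof -
  obtain u v where e: "e = {u,v}" "E u v" using assms(2) unfolding edges_def by blast
  then have "u \<noteq> v" using assms(1) unfolding simple_graph_def by auto
  then show "card e = 2" using e(1) by auto
qed

text \<open>\<open>X\<close> is the union of spanning trees of the five branch sets, and
  \<open>Y\<close> has one edge for each of the ten pairs of them. Contracting the trees maps an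
  even set to an even subgraph of \<open>K\<^sub>5\<close>, which is empty if it has at most two
  edges; what remains lies in the forest \<open>X\<close>.\<close>

lemma K5_model_skeleton:
  assumes G: "simple_graph V E" and \<B>: "K_model V E \<B>" "card \<B> = 5" "\<Union>\<B> = V"
  obtains X Y where "X \<subseteq> edges E" "Y \<subseteq> edges E" "X \<inter> Y = {}" "card X + 5 = card V" "card Y = 10"
    "\<forall>Z\<subseteq>X \<union> Y. even_subgraph Z \<longrightarrow> card (Z \<inter> Y) \<le> 2 \<longrightarrow> Z = {}"
proof -
  have finV: "finite V" using G unfolding simple_graph_def by blast
  have fin\<B>: "finite \<B>" using \<B>(2) by (simp add: card_ge_0_finite)
  have finB: "finite B" if "B \<in> \<B>" for B
    using finV K_modelD(2)[OF \<B>(1) that] finite_subset by blast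
  note disj = K_model_disjoint[OF \<B>(1)]
  have "\<exists>T. T \<subseteq> edges E \<inter> Pow B \<and> Suc (card T) = card B \<and> (\<forall>Z\<subseteq>T. even_subgraph Z \<longrightarrow> Z = {})"
    if "B \<in> \<B>" for B
    using connected_in_spanning_tree[of E B] K_modelD[OF \<B>(1) that] finB[OF that] by blast
  then obtain T where T: "\<And>B. B \<in> \<B> \<Longrightarrow> T B \<subseteq> edges E \<inter> Pow B"
      "\<And>B. B \<in> \<B> \<Longrightarrow> Suc (card (T B)) = card B"
      "\<And>B Z. B \<in> \<B> \<Longrightarrow> Z \<subseteq> T B \<Longrightarrow> even_subgraph Z \<Longrightarrow> Z = {}"
    by metis
  define X where "X = (\<Union>B\<in>\<B>. T B)"
  have TB: "e \<subseteq> B" "card e = 2" if "B \<in> \<B>" "e \<in> T B" for B e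
    using T(1)[OF that(1)] that(2) card_edge[OF G, of e] by auto
  have finT: "finite (T B)" if "B \<in> \<B>" for B
    using TB(1)[OF that] finB[OF that] by (meson Pow_iff finite_Pow_iff finite_subset subsetI)
  have Tdisj: "T B \<inter> T C = {}" if BC: "B \<in> \<B>" "C \<in> \<B>" "B \<noteq> C" for B C
  proof (rule ccontr)
    assume "T B \<inter> T C \<noteq> {}"
    then obtain e where e: "e \<in> T B" "e \<in> T C" by blast
    then have "e \<subseteq> B" "e \<subseteq> C" "card e = 2" using TB BC by blast+
    moreover from this obtain x where "x \<in> e" by (metis card.empty ex_in_conv zero_neq_numeral)
    ultimately show False using disj[OF BC(1,2)] BC(3) by blast
  qed
  have cardX: "card X + 5 = card V"
  proof -
    have "card X = (\<Sum>B\<in>\<B>. card (T B))"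
      unfolding X_def using fin\<B> finT Tdisj by (intro card_UN_disjoint) auto
    then have "card X + 5 = (\<Sum>B\<in>\<B>. Suc (card (T B)))"
      using \<B>(2) by (simp only: Suc_eq_plus1 sum.distrib) simp
    also have "\<dots> = (\<Sum>B\<in>\<B>. card B)" using T(2) by simp
    also have "\<dots> = card (\<Union>\<B>)"
      using finB disj by (intro card_Union_disjoint[symmetric]) (auto simp: pairwise_def disjnt_def)
    finally show ?thesis using \<B>(3) by simp
  qed
  define Ps where "Ps = {P. P \<subseteq> \<B> \<and> card P = 2}"
  have "card Ps = 5 choose 2" unfolding Ps_def using n_subsets[OF fin\<B>] \<B>(2) by simp
  then have cardPs: "card Ps = 10" by (simp add: choose_two)
  \<comment> \<open>The pair is recovered from its edge as the branch sets that the edge meets,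
    which makes the choice of edges injective.\<close>
  have ex: "\<exists>e. e \<in> edges E \<and> P = {B\<in>\<B>. B \<inter> e \<noteq> {}} \<and> (\<forall>B\<in>P. card (B \<inter> e) = 1)" if P: "P \<in> Ps" for P
  proof -
    obtain B C where BC: "P = {B,C}" "B \<noteq> C" "B \<in> \<B>" "C \<in> \<B>"
      using P unfolding Ps_def by (auto simp: card_2_iff)
    obtain x y where xy: "x \<in> B" "y \<in> C" "E x y" using K_model_adjacent[OF \<B>(1) BC(3,4,2)] .
    have "y \<notin> B" "x \<notin> C" using disj[OF BC(3,4)] xy BC(2) by blast+
    then have "B \<inter> {x,y} = {x}" "C \<inter> {x,y} = {y}" using xy by blast+
    then have "\<forall>B\<in>P. card (B \<inter> {x,y}) = 1" using BC(1) by simp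
    moreover have "P = {B\<in>\<B>. B \<inter> {x,y} \<noteq> {}}"
    proof
      show "P \<subseteq> {B\<in>\<B>. B \<inter> {x,y} \<noteq> {}}" using BC xy by blast
      show "{B\<in>\<B>. B \<inter> {x,y} \<noteq> {}} \<subseteq> P"
        using disj[OF _ BC(3), of _ x] disj[OF _ BC(4), of _ y] xy BC(1) by blast
    qed
    moreover have "{x,y} \<in> edges E" using xy(3) unfolding edges_def by blast
    ultimately show ?thesis by blast
  qed
  have "\<forall>P\<in>Ps. \<exists>e. e \<in> edges E \<and> P = {B\<in>\<B>. B \<inter> e \<noteq> {}} \<and> (\<forall>B\<in>P. card (B \<inter> e) = 1)"
    using ex by (rule ballI)
  from bchoice[OF this] obtain ed where ed_all: "\<forall>P\<in>Ps. ed P \<in> edges E \<and>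
      P = {B\<in>\<B>. B \<inter> ed P \<noteq> {}} \<and> (\<forall>B\<in>P. card (B \<inter> ed P) = 1)" ..
  have ed: "ed P \<in> edges E" "P = {B\<in>\<B>. B \<inter> ed P \<noteq> {}}" if "P \<in> Ps" for P
    using bspec[OF ed_all that] by auto
  have ed_card: "card (B \<inter> ed P) = 1" if "P \<in> Ps" "B \<in> P" for P B
    using bspec[OF ed_all that(1)] that(2) by blast
  have inj: "inj_on ed Ps" 
  proof (rule inj_onI)
    fix P P' assume "P \<in> Ps" "P' \<in> Ps" "ed P = ed P'"
    then show "P = P'" using ed(2)[of P] ed(2)[of P'] by simp
  qed
  define Y where "Y = ed ` Ps"
  have cardY: "card Y = 10" unfolding Y_def using card_image[OF inj] cardPs by simp
  have XY: "X \<inter> Y = {}"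
  proof (rule ccontr)
    assume "X \<inter> Y \<noteq> {}"
    then obtain B P where BP: "B \<in> \<B>" "P \<in> Ps" "ed P \<in> T B" unfolding X_def Y_def by auto
    have "P \<subseteq> {B}"
    proof
      fix C assume "C \<in> P"
      then obtain x where "C \<in> \<B>" "x \<in> C" "x \<in> ed P" using ed(2)[OF BP(2)] by blast
      then have "C = B" using TB(1)[OF BP(1,3)] disj[OF _ BP(1), of C x] by blast
      then show "C \<in> {B}" by simp
    qed
    then have "card P \<le> 1" using card_mono[of "{B}" P] by simp
    then show False using BP(2) unfolding Ps_def by simp
  qed
  have rigid: "Z = {}" if Z: "Z \<subseteq> X \<union> Y" "even_subgraph Z" "card (Z \<inter> Y) \<le> 2" for Z
  proof -
    have "finite X" "finite Y" unfolding X_def using fin\<B> finT cardY by (auto intro: card_ge_0_finite)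
    then have finZ: "finite Z" using Z(1) finite_subset by blast
    define Q where "Q = {P\<in>Ps. ed P \<in> Z}"
    have "ed ` Q = Z \<inter> Y" unfolding Q_def Y_def by blast
    moreover have "inj_on ed Q" using inj unfolding Q_def by (rule inj_on_subset) blast
    ultimately have "card Q \<le> 2" using Z(3) card_image[of ed Q] by simp
    have "finite Ps" using cardPs by (simp add: card_ge_0_finite)
    then have finQ: "finite Q" unfolding Q_def by simp
    \<comment> \<open>Handshake count modulo 2 inside \<open>B\<close>: a tree edge has two ends or
      none in \<open>B\<close>, and a connecting edge has one exactly if its pair contains
      \<open>B\<close>.\<close>
    have even_Q: "even (card {P\<in>Q. B \<in> P})" if B: "B \<in> \<B>" for B
    proof -
      have "(\<Sum>v\<in>B. card {e\<in>Z. v \<in> e}) = (\<Sum>e\<in>Z. card {v\<in>B. v \<in> e})"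
        using finB[OF B] finZ by (intro sum_multicount_gen) auto
      moreover have "even (\<Sum>v\<in>B. card {e\<in>Z. v \<in> e})"
        using Z(2) unfolding even_subgraph_def by (intro dvd_sum) blast
      ultimately have "even (\<Sum>e\<in>Z. card {v\<in>B. v \<in> e})" by simp
      then have "even (card {e\<in>Z. odd (card {v\<in>B. v \<in> e})})" 
        using even_sum_iff[OF finZ, of "\<lambda>e. card {v\<in>B. v \<in> e}"] by simp
      moreover have "{e\<in>Z. odd (card {v\<in>B. v \<in> e})} = ed ` {P\<in>Q. B \<in> P}"
      proof (intro set_eqI iffI)
        fix e assume e: "e \<in> {e\<in>Z. odd (card {v\<in>B. v \<in> e})}"
        then have "e \<in> X \<or> e \<in> Y" using Z(1) by blast
        then show "e \<in> ed ` {P\<in>Q. B \<in> P}"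
        proof
          assume "e \<in> X"
          then obtain C where C: "C \<in> \<B>" "e \<in> T C" unfolding X_def by blast
          have "even (card {v\<in>B. v \<in> e})"
          proof (cases "C = B")
            case True
            then have "{v\<in>B. v \<in> e} = e" using TB(1)[OF C] by blast
            then show ?thesis using TB(2)[OF C] by simp
          next
            case False
            then have "{v\<in>B. v \<in> e} = {}" using TB(1)[OF C] disj[OF C(1) B] by blast
            then show ?thesis by (simp only: card.empty even_zero)
          qed
          then show ?thesis using e by blast
        next
          assume "e \<in> Y"
          then obtain P where P: "P \<in> Ps" "e = ed P" unfolding Y_def by blast
          have "{v\<in>B. v \<in> e} \<noteq> {}" 
          proof
            assume "{v\<in>B. v \<in> e} = {}"
            then have "card {v\<in>B. v \<in> e} = 0" by (simp only: card.empty)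
            with e show False by simp
          qed
          then have "B \<in> P" using ed(2)[OF P(1)] B P(2) by blast
          then show ?thesis using P e unfolding Q_def by blast
        qed
      next
        fix e assume "e \<in> ed ` {P\<in>Q. B \<in> P}"
        then obtain P where P: "P \<in> Ps" "ed P \<in> Z" "B \<in> P" "e = ed P" unfolding Q_def by blast
        have "{v\<in>B. v \<in> e} = B \<inter> ed P" using P(4) by blast
        then show "e \<in> {e\<in>Z. odd (card {v\<in>B. v \<in> e})}" using ed_card[OF P(1,3)] P by simp
      qed
      moreover have "inj_on ed {P\<in>Q. B \<in> P}" using inj unfolding Q_def by (rule inj_on_subset) blast
      ultimately show ?thesis by (simp add: card_image)
    qed
    \<comment> \<open>With at most two pairs in \<open>Q\<close>, evenness at the members of
      \<open>P\<close> forces them all into a second pair \<open>P'\<close>. Both pairs have size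
      two, so they would coincide; a single pair would have odd degree at its ends.\<close>
    have "Q = {}"
    proof (rule ccontr)
      assume "Q \<noteq> {}"
      then obtain P where P: "P \<in> Q" by blast
      have "\<exists>P'. Q \<subseteq> {P, P'}"
      proof -
        have "card (Q - {P}) \<le> 1" using \<open>card Q \<le> 2\<close> P finQ by simp
        then obtain P' where "Q - {P} \<subseteq> {P'}" using finQ
          by (metis card_le_Suc0_iff_eq One_nat_def finite_Diff insertCI subsetI)
        then show ?thesis by blast
      qed
      then obtain P' where P': "Q \<subseteq> {P, P'}" by blast
      have "P \<subseteq> P'"
      proof
        fix B assume B: "B \<in> P"
        show "B \<in> P'"
        proof (rule ccontr)
          assume "B \<notin> P'"
          then have "{P\<in>Q. B \<in> P} = {P}" using P P' B by blast
          moreover have "B \<in> \<B>" using P B unfolding Q_def Ps_def by blast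
          ultimately show False using even_Q[of B] by simp
        qed
      qed
      show False
      proof (cases "P' \<in> Q \<and> P' \<noteq> P")
        case True
        then have "P \<in> Ps" "P' \<in> Ps" using P unfolding Q_def by blast+
        then have "card P = 2" "card P' = 2" unfolding Ps_def by blast+
        then show False
          using True \<open>P \<subseteq> P'\<close> card_subset_eq[of P' P] card_ge_0_finite[of P'] by simp
      next
        case False
        then have "Q = {P}" using P P' by blast
        have "card P = 2" "P \<subseteq> \<B>" using P unfolding Q_def Ps_def by blast+
        then have "P \<noteq> {}" by auto
        then obtain B where "B \<in> P" "B \<in> \<B>" using \<open>P \<subseteq> \<B>\<close> by blast
        with \<open>Q = {P}\<close> have "{P'\<in>Q. B \<in> P'} = {P}" by blast
        then show False using even_Q[OF \<open>B \<in> \<B>\<close>] by simp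
      qed
    qed
    then have "Z \<inter> Y = {}" unfolding Q_def Y_def by blast
    then have ZX: "Z \<subseteq> X" using Z(1) by blast
    \<comment> \<open>The trees are vertex-disjoint, so at a vertex of \<open>B\<close> all edges of
      \<open>Z\<close> belong to \<open>T B\<close>, and the part of \<open>Z\<close> in
      \<open>T B\<close> is itself even.\<close>
    have "Z \<inter> T B = {}" if B: "B \<in> \<B>" for B
    proof (rule T(3)[OF B])
      show "even_subgraph (Z \<inter> T B)"
        unfolding even_subgraph_def
      proof
        fix v
        show "even (card {e\<in>Z \<inter> T B. v \<in> e})"
        proof (cases "v \<in> B")
          case True
          have "{e\<in>Z \<inter> T B. v \<in> e} = {e\<in>Z. v \<in> e}"
          proof -
            have "e \<in> T B" if e: "e \<in> Z" "v \<in> e" for e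
            proof -
              obtain C where C: "C \<in> \<B>" "e \<in> T C" using e ZX unfolding X_def by blast
              then have "C = B" using TB(1)[OF C] disj[OF C(1) B] e(2) True by blast
              then show ?thesis using C(2) by simp
            qed
            then show ?thesis by blast
          qed
          then show ?thesis using Z(2) unfolding even_subgraph_def by simp
        next
          case False
          then have "{e\<in>Z \<inter> T B. v \<in> e} = {}" using TB(1)[OF B] by blast
          then show ?thesis by (simp only: card.empty even_zero)
        qed
      qed
    qed blast
    then show "Z = {}" using ZX unfolding X_def by blast
  qed
  have "X \<subseteq> edges E" unfolding X_def using T(1) by blast
  moreover have "Y \<subseteq> edges E" unfolding Y_def using ed(1) by blast
  moreover have "\<forall>Z\<subseteq>X \<union> Y. even_subgraph Z \<longrightarrow> card (Z \<inter> Y) \<le> 2 \<longrightarrow> Z = {}"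
    using rigid by simp
  ultimately show thesis using XY cardX cardY that by simp
qed

text \<open>The condition on \<open>R\<close> says that the dual graph is connected; the last one is Euler's formula
  with the number of edges eliminated by \<open>3 |F| = 2 |E|\<close>.\<close>

definition triangulated_sphere :: "'a set set \<Rightarrow> bool" where
  "triangulated_sphere F \<longleftrightarrow> finite F \<and> F \<noteq> {} \<and> (\<forall>f\<in>F. card f = 3) \<and>
     (\<forall>f\<in>F. \<forall>e\<subseteq>f. card e = 2 \<longrightarrow> card {g\<in>F. e \<subseteq> g} = 2) \<and>
     (\<forall>R\<subseteq>F. R \<noteq> {} \<longrightarrow> (\<forall>f\<in>R. \<forall>g\<in>F. card (f \<inter> g) = 2 \<longrightarrow> g \<in> R) \<longrightarrow> R = F) \<and>
     card F + 4 = 2 * card (\<Union>F)"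

definition face_adj :: "'a set set \<Rightarrow> 'a \<Rightarrow> 'a \<Rightarrow> bool" where
  "face_adj F u v \<longleftrightarrow> u \<noteq> v \<and> (\<exists>f\<in>F. u \<in> f \<and> v \<in> f)"

lemma edges_face_adj: "edges (face_adj F) = {e. card e = 2 \<and> (\<exists>f\<in>F. e \<subseteq> f)}"
  unfolding edges_def face_adj_def card_2_iff by auto

lemma simple_graph_face_adj:
  assumes "finite F" "\<forall>f\<in>F. finite f"
  shows "simple_graph (\<Union>F) (face_adj F)"
  using assms unfolding simple_graph_def face_adj_def by auto

text \<open>The boundary of a triangle is an even edge set: a corner lies on two sides, any other
  vertex on none.\<close>

lemma card_pairs_at_vertex:
  assumes "card f = 3"
  shows "even (card {e. e \<subseteq> f \<and> card e = 2 \<and> v \<in> e})"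
proof (cases "v \<in> f")
  case True
  have "card (f - {v}) = 2" using assms True by (simp add: card_ge_0_finite)
  have "{e. e \<subseteq> f \<and> card e = 2 \<and> v \<in> e} = (\<lambda>u. {u,v}) ` (f - {v})"
  proof (intro set_eqI iffI)
    fix e assume "e \<in> {e. e \<subseteq> f \<and> card e = 2 \<and> v \<in> e}"
    then obtain x y where "e = {x,y}" "x \<noteq> y" "v \<in> {x,y}" "{x,y} \<subseteq> f" unfolding card_2_iff by blast
    then show "e \<in> (\<lambda>u. {u,v}) ` (f - {v})" by auto
  qed (use True in auto)
  moreover have "inj_on (\<lambda>u. {u,v}) (f - {v})" by (auto simp: inj_on_def doubleton_eq_iff)
  ultimately have "card {e. e \<subseteq> f \<and> card e = 2 \<and> v \<in> e} = 2"
    using \<open>card (f - {v}) = 2\<close> by (simp add: card_image)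
  then show ?thesis by simp
next
  case False
  then have "{e. e \<subseteq> f \<and> card e = 2 \<and> v \<in> e} = {}" by blast
  then show ?thesis by (simp only: card.empty even_zero)
qed

section \<open>Connectedness, Euler's formula and the exclusion of \<open>K\<^sub>5\<close>\<close>

context
  fixes F :: "'a set set"
  assumes F: "triangulated_sphere F"
begin

lemma triangulated_sphere_face: "f \<in> F \<Longrightarrow> card f = 3"
  using F unfolding triangulated_sphere_def by simp

lemma triangulated_sphere_finite: "finite F" "f \<in> F \<Longrightarrow> finite f" "finite (\<Union>F)"
proof -
  show 1: "finite F" using F unfolding triangulated_sphere_def by blast
  show 2: "finite f" if "f \<in> F" for f
    using triangulated_sphere_face[OF that] by (simp add: card_ge_0_finite)
  show "finite (\<Union>F)" using 1 2 by blast
qed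

lemma triangulated_sphere_edge: "e \<in> edges (face_adj F) \<Longrightarrow> card {f\<in>F. e \<subseteq> f} = 2"
  using F unfolding triangulated_sphere_def edges_face_adj by blast

text \<open>Two faces with two common vertices share an edge, so closure under crossing edges gives
  the closure demanded in the definition.\<close>

lemma triangulated_sphere_dual_connected:
  assumes "R \<subseteq> F" "R \<noteq> {}"
    and "\<And>e f g. e \<in> edges (face_adj F) \<Longrightarrow> f \<in> R \<Longrightarrow> g \<in> F \<Longrightarrow> e \<subseteq> f \<Longrightarrow> e \<subseteq> g \<Longrightarrow> g \<in> R"
  shows "R = F"
proof -
  have "g \<in> R" if "f \<in> R" "g \<in> F" "card (f \<inter> g) = 2" for f g
  proof (rule assms(3)[OF _ that(1,2)])
    show "f \<inter> g \<in> edges (face_adj F)" unfolding edges_face_adj using that by blast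
  qed auto
  then show ?thesis using F assms(1,2) unfolding triangulated_sphere_def by simp
qed

text \<open>If no edge leaves \<open>A\<close>, a face that meets \<open>A\<close> lies in
  \<open>A\<close>. The faces inside \<open>A\<close> are then closed under crossing an edge, so
  they are all faces.\<close>

lemma triangulated_sphere_connected: "connected_in (face_adj F) (\<Union>F)"
  unfolding connected_in_def
proof (intro allI impI, rule ccontr)
  fix A assume A: "A \<subseteq> \<Union>F" "A \<noteq> {}" "A \<noteq> \<Union>F"
    and no: "\<not> (\<exists>x\<in>A. \<exists>y\<in>\<Union>F - A. face_adj F x y)"
  have face: "f \<subseteq> A" if "f \<in> F" "x \<in> f" "x \<in> A" for f x
  proof
    fix y assume "y \<in> f"
    then show "y \<in> A" using no that unfolding face_adj_def by (cases "x = y") blast+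
  qed
  define R where "R = {f\<in>F. f \<subseteq> A}"
  have "R = F"
  proof (rule triangulated_sphere_dual_connected)
    show "R \<subseteq> F" unfolding R_def by blast
    obtain x where "x \<in> A" using A(2) by blast
    then obtain f where "f \<in> F" "x \<in> f" using A(1) by blast
    then show "R \<noteq> {}" using face[of f x] \<open>x \<in> A\<close> unfolding R_def by blast
    fix e f g assume e: "e \<in> edges (face_adj F)" "f \<in> R" "g \<in> F" "e \<subseteq> f" "e \<subseteq> g"
    then have "e \<noteq> {}" unfolding edges_face_adj by auto
    then obtain x where "x \<in> e" by blast
    then show "g \<in> R" using face[of g x] e unfolding R_def by blast
  qed
  then show False using A unfolding R_def by blast
qed

text \<open>Double counting of incidences, with three edges on a face and two faces at an edge,
  brings the number of edges back into the formula.\<close>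

lemma triangulated_sphere_Euler: "card F + card (\<Union>F) = card (edges (face_adj F)) + 2"
proof -
  let ?E = "edges (face_adj F)"
  have "?E \<subseteq> Pow (\<Union>F)" unfolding edges_face_adj by blast
  then have finE: "finite ?E" using triangulated_sphere_finite(3) finite_subset by blast
  have "(\<Sum>f\<in>F. card {e\<in>?E. e \<subseteq> f}) = (\<Sum>e\<in>?E. 2)"
    using triangulated_sphere_finite(1) finE triangulated_sphere_edge by (intro sum_multicount_gen) auto
  moreover have "card {e\<in>?E. e \<subseteq> f} = 3" if f: "f \<in> F" for f
  proof -
    have "{e\<in>?E. e \<subseteq> f} = {e. e \<subseteq> f \<and> card e = 2}" unfolding edges_face_adj using f by blast
    moreover have "card f = 3" using triangulated_sphere_face[OF f] .
    ultimately show ?thesis using n_subsets[OF triangulated_sphere_finite(2)[OF f], of 2]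
      by (simp add: choose_two)
  qed
  ultimately have "card F * 3 = card ?E * 2" by simp
  then show ?thesis using F unfolding triangulated_sphere_def by simp
qed

text \<open>The boundary modulo 2 of a set of faces is an even edge set. For a class of faces closed
  under crossing the edges outside the skeleton it lies in \<open>X \<union> Y\<close>; if it meets
  \<open>Y\<close> at most twice, rigidity makes it empty, so by dual connectedness the class
  contains every face.\<close>

theorem triangulated_sphere_K5_model_free: "K_model_free (\<Union>F) (face_adj F) 5"
  unfolding K_model_free_def
proof (intro allI impI notI)
  let ?V = "\<Union>F" and ?E = "face_adj F"
  fix \<B>0 assume \<B>0: "K_model ?V ?E \<B>0" "card \<B>0 = 5"
  have G: "simple_graph ?V ?E"
    using simple_graph_face_adj triangulated_sphere_finite(1,2) by blast
  have "symp ?E" unfolding face_adj_def by (auto intro: sympI)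
  moreover have "\<B>0 \<noteq> {}" using \<B>0(2) by auto
  ultimately obtain \<B> where \<B>: "K_model ?V ?E \<B>" "card \<B> = 5" "\<Union>\<B> = ?V"
    using K_model_extend_spanning[OF \<B>0(1) triangulated_sphere_connected triangulated_sphere_finite(3)]
      \<B>0(2) by metis
  obtain X Y where X: "X \<subseteq> edges ?E" and Y: "Y \<subseteq> edges ?E" and "X \<inter> Y = {}"
    and cards: "card X + 5 = card ?V" "card Y = 10"
    and "\<forall>Z\<subseteq>X \<union> Y. even_subgraph Z \<longrightarrow> card (Z \<inter> Y) \<le> 2 \<longrightarrow> Z = {}"
    using K5_model_skeleton[OF G \<B>] .
  then have rigid: "Z = {}" if "Z \<subseteq> X \<union> Y" "even_subgraph Z" "card (Z \<inter> Y) \<le> 2" for Z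
    using that by simp
  have finF: "finite F" using triangulated_sphere_finite(1) .
  have "edges ?E \<subseteq> Pow ?V" unfolding edges_face_adj by blast
  then have finE: "finite (edges ?E)" using triangulated_sphere_finite(3) finite_subset by blast
  define W where "W = edges ?E - (X \<union> Y)"
  have "finite X" "finite Y" using X Y finE finite_subset by blast+
  then have "card (X \<union> Y) = card X + card Y" using \<open>X \<inter> Y = {}\<close> by (rule card_Un_disjoint)
  moreover have "card W + card (X \<union> Y) = card (edges ?E)"
    unfolding W_def using finE X Y by (metis Un_least card_Diff_subset card_mono finite_subset le_add_diff_inverse2)
  \<comment> \<open>\<open>X\<close> has \<open>card V - 5\<close> edges and \<open>Y\<close> has
    ten; Euler's formula converts the number of remaining edges into
    \<open>card F - 7\<close>.\<close>
  ultimately have cardW: "card F = card W + 7"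
    using cards triangulated_sphere_Euler by linarith
  have "\<exists>p. \<exists>q. {f\<in>F. e \<subseteq> f} = {p,q}" if "e \<in> edges ?E" for e
    using triangulated_sphere_edge[OF that] unfolding card_2_iff by blast
  then obtain p q where pq: "\<And>e. e \<in> edges ?E \<Longrightarrow> {f\<in>F. e \<subseteq> f} = {p e, q e}" by metis
  have "finite W" unfolding W_def using finE by simp
  \<comment> \<open>Faces that share an edge outside the skeleton receive the same label, so only
    skeleton edges separate different labels.\<close>
  obtain c :: "'a set \<Rightarrow> 'a set" where c: "card F \<le> card (c ` F) + card W" "\<forall>e\<in>W. c (p e) = c (q e)"
    using merge_classes[OF finF \<open>finite W\<close>, of p q] by blast
  have classes: "card (c ` F) \<ge> 7" using c(1) cardW by linarith
  define s where "s r = (\<Sum>e\<in>Y. card {f\<in>F. e \<subseteq> f \<and> c f = r})" for r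
  \<comment> \<open>The ten edges of \<open>Y\<close> have twenty sides in all, while seven classes
    with three sides each would need twenty-one.\<close>
  have "\<exists>r\<in>c ` F. s r \<le> 2"
  proof (rule ccontr)
    assume "\<not> ?thesis"
    then have "(\<Sum>r\<in>c ` F. 3) \<le> (\<Sum>r\<in>c ` F. s r)" by (intro sum_mono) auto
    also have "\<dots> = (\<Sum>e\<in>Y. \<Sum>r\<in>c ` F. card {f\<in>F. e \<subseteq> f \<and> c f = r})"
      unfolding s_def by (rule sum.swap)
    also have "\<dots> = (\<Sum>e\<in>Y. 2)"
    proof (rule sum.cong)
      fix e assume "e \<in> Y"
      have "(\<Sum>r\<in>c ` F. card {f\<in>F. e \<subseteq> f \<and> c f = r})
          = card (\<Union>r\<in>c ` F. {f\<in>F. e \<subseteq> f \<and> c f = r})"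
        using finF by (intro card_UN_disjoint[symmetric]) auto
      also have "(\<Union>r\<in>c ` F. {f\<in>F. e \<subseteq> f \<and> c f = r}) = {f\<in>F. e \<subseteq> f}" by blast
      finally show "(\<Sum>r\<in>c ` F. card {f\<in>F. e \<subseteq> f \<and> c f = r}) = 2"
        using triangulated_sphere_edge[of e] Y \<open>e \<in> Y\<close> by auto
    qed simp
    finally show False using classes cards(2) by simp
  qed
  then obtain r where r: "r \<in> c ` F" "s r \<le> 2" by blast
  define R where "R = {f\<in>F. c f = r}"
  \<comment> \<open>The boundary modulo 2 of the class \<open>R\<close>.\<close>
  define Z where "Z = {e\<in>edges ?E. odd (card {f\<in>R. e \<subseteq> f})}"
  have finR: "finite R" unfolding R_def using finF by simp
  have "Z = {}"
  proof (rule rigid)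
    show "Z \<subseteq> X \<union> Y"
    proof (rule ccontr)
      assume "\<not> ?thesis"
      then obtain e where e: "e \<in> W" "odd (card {f\<in>R. e \<subseteq> f})" unfolding Z_def W_def by blast
      then have E: "e \<in> edges ?E" unfolding W_def by blast
      have "{f\<in>R. e \<subseteq> f} = {f \<in> {p e, q e}. c f = r}" unfolding pq[OF E, symmetric] R_def by blast
      also have "\<dots> = {} \<or> \<dots> = {p e, q e}" using c(2) e(1) by auto
      moreover have "card {p e, q e} = 2" using triangulated_sphere_edge[OF E] pq[OF E] by simp
      ultimately have "even (card {f\<in>R. e \<subseteq> f})" by (metis card.empty even_zero dvd_refl)
      then show False using e(2) by simp
    qed
    show "even_subgraph Z"
      unfolding even_subgraph_def
    proof
      fix v
      let ?Ev = "{e\<in>edges ?E. v \<in> e}"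
      have "(\<Sum>e\<in>?Ev. card {f\<in>R. e \<subseteq> f}) = (\<Sum>f\<in>R. card {e\<in>?Ev. e \<subseteq> f})"
        using finE finR by (intro sum_multicount_gen) auto
      moreover have "even (card {e\<in>?Ev. e \<subseteq> f})" if "f \<in> R" for f
      proof -
        have f: "f \<in> F" using that unfolding R_def by blast
        then have "{e\<in>?Ev. e \<subseteq> f} = {e. e \<subseteq> f \<and> card e = 2 \<and> v \<in> e}"
          unfolding edges_face_adj by blast
        moreover have "card f = 3" using triangulated_sphere_face[OF f] .
        ultimately show ?thesis using card_pairs_at_vertex[of f v] by simp
      qed
      ultimately have "even (\<Sum>e\<in>?Ev. card {f\<in>R. e \<subseteq> f})" by (simp add: dvd_sum)
      then have "even (card {e\<in>?Ev. odd (card {f\<in>R. e \<subseteq> f})})"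
        using finE even_sum_iff[of ?Ev "\<lambda>e. card {f\<in>R. e \<subseteq> f}"] by simp
      moreover have "{e\<in>?Ev. odd (card {f\<in>R. e \<subseteq> f})} = {e\<in>Z. v \<in> e}" unfolding Z_def by blast
      ultimately show "even (card {e\<in>Z. v \<in> e})" by simp
    qed
    have "card (Z \<inter> Y) = (\<Sum>e\<in>Z \<inter> Y. 1)" by simp
    also have "\<dots> \<le> (\<Sum>e\<in>Z \<inter> Y. card {f\<in>F. e \<subseteq> f \<and> c f = r})"
    proof (rule sum_mono)
      fix e assume "e \<in> Z \<inter> Y"
      then have "odd (card {f\<in>R. e \<subseteq> f})" unfolding Z_def by blast
      moreover have "{f\<in>R. e \<subseteq> f} = {f\<in>F. e \<subseteq> f \<and> c f = r}" unfolding R_def by blast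
      ultimately show "1 \<le> card {f\<in>F. e \<subseteq> f \<and> c f = r}" using odd_pos by (simp add: Suc_leI)
    qed
    also have "\<dots> \<le> s r" unfolding s_def using \<open>finite Y\<close> by (intro sum_mono2) auto
    finally show "card (Z \<inter> Y) \<le> 2" using r(2) by simp
  qed
  \<comment> \<open>With empty boundary, every edge of a face in \<open>R\<close> has both its faces
    in \<open>R\<close>.\<close>
  have "R = F"
  proof (rule triangulated_sphere_dual_connected)
    show "R \<subseteq> F" "R \<noteq> {}" unfolding R_def using r(1) by auto
    fix e f g assume e: "e \<in> edges ?E" "f \<in> R" "g \<in> F" "e \<subseteq> f" "e \<subseteq> g"
    have "even (card {f\<in>R. e \<subseteq> f})" using e(1) \<open>Z = {}\<close> unfolding Z_def by blast
    moreover have "card {f\<in>R. e \<subseteq> f} \<noteq> 0" using e finR by (auto simp: card_eq_0_iff)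
    ultimately have "card {f\<in>R. e \<subseteq> f} \<ge> 2" by (metis One_nat_def Suc_1 Suc_leI dvd_imp_le neq0_conv)
    moreover have sub: "{f\<in>R. e \<subseteq> f} \<subseteq> {f\<in>F. e \<subseteq> f}" unfolding R_def by blast
    ultimately have "{f\<in>R. e \<subseteq> f} = {f\<in>F. e \<subseteq> f}"
      using triangulated_sphere_edge[OF e(1)] finF by (intro card_seteq) auto
    then show "g \<in> R" using e by blast
  qed
  then have "c ` F \<subseteq> {r}" unfolding R_def by blast
  then have "card (c ` F) \<le> 1" using card_mono[of "{r}" "c ` F"] by simp
  then show False using classes by simp
qed

end

section \<open>Gluing gadgets that forbid a colouring of a clique\<close>

text \<open>Odd colours form the classes of size one, even colours the class of size two; \<open>M v\<close> is the even
  part of the list of \<open>v\<close>.\<close>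

definition singles :: "nat \<Rightarrow> nat set" where
  "singles k = (\<lambda>i. 2 * i + 1) ` {..<k}"

text \<open>\<open>k\<close> stands for \<open>t - 3\<close>, so \<open>k + 3\<close> is the order
  of the excluded clique. Natural numbers as vertices leave room for fresh vertices and shifted
  copies.\<close>

definition list_graph :: "nat \<Rightarrow> nat set \<Rightarrow> (nat \<Rightarrow> nat \<Rightarrow> bool) \<Rightarrow> (nat \<Rightarrow> nat set) \<Rightarrow> bool" where
  "list_graph k V E M \<longleftrightarrow> simple_graph V E \<and> K_model_free V E (k + 3) \<and>
     (\<forall>v\<in>V. M v \<subseteq> Collect even \<and> card (M v) = 2)"

definition colours :: "nat \<Rightarrow> (nat \<Rightarrow> nat \<Rightarrow> bool) \<Rightarrow> (nat \<Rightarrow> nat set) \<Rightarrow> nat set \<Rightarrow> (nat \<Rightarrow> nat) \<Rightarrow> bool" where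
  "colours k E M A f \<longleftrightarrow> (\<forall>v\<in>A. f v \<in> singles k \<union> M v) \<and> (\<forall>u v. E u v \<longrightarrow> f u \<noteq> f v)"

definition clique_list :: "'a set \<Rightarrow> ('a \<Rightarrow> 'a \<Rightarrow> bool) \<Rightarrow> 'a list \<Rightarrow> bool" where
  "clique_list V E xs \<longleftrightarrow> distinct xs \<and> set xs \<subseteq> V \<and> (\<forall>x\<in>set xs. \<forall>y\<in>set xs. x \<noteq> y \<longrightarrow> E x y)"

text \<open>A colour sequence is dead if some gadget prevents it from appearing on a clique; the vertices of
  the clique itself carry no list constraint.\<close>

definition dead :: "nat \<Rightarrow> nat list \<Rightarrow> bool" where
  "dead k cs \<longleftrightarrow> (\<exists>V E M xs. list_graph k V E M \<and> clique_list V E xs \<and> length xs = length cs \<and>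
     (\<forall>f. colours k E M (V - set xs) f \<longrightarrow> map f xs \<noteq> cs))"

section \<open>Renaming and gluing gadgets\<close>

lemma K_model_image:
  assumes "K_model V E \<B>" "inj_on h V" and E: "\<And>u v. u \<in> V \<Longrightarrow> v \<in> V \<Longrightarrow> E u v \<Longrightarrow> E' (h u) (h v)"
  shows "K_model (h ` V) E' ((`) h ` \<B>)" "card ((`) h ` \<B>) = card \<B>"
proof -
  have sub: "B \<subseteq> V" if "B \<in> \<B>" for B using K_modelD(2)[OF assms(1) that] .
  have "inj_on ((`) h) \<B>"
    using sub inj_on_image_eq_iff[OF assms(2)] by (auto intro: inj_onI)
  then show "card ((`) h ` \<B>) = card \<B>" by (rule card_image)
  show "K_model (h ` V) E' ((`) h ` \<B>)"
    unfolding K_model_def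
  proof (intro conjI ballI impI)
    fix B' assume "B' \<in> (`) h ` \<B>"
    then obtain B where B: "B \<in> \<B>" "B' = h ` B" by blast
    show "B' \<noteq> {}" "B' \<subseteq> h ` V" using B K_modelD(1,2)[OF assms(1) B(1)] by auto
    show "connected_in E' B'"
      unfolding connected_in_def
    proof (intro allI impI)
      fix A' assume A': "A' \<subseteq> B'" "A' \<noteq> {}" "A' \<noteq> B'"
      define A where "A = {x\<in>B. h x \<in> A'}"
      have hA: "h ` A = A'" unfolding A_def using A'(1) B(2) by blast
      then have "A \<subseteq> B" "A \<noteq> {}" "A \<noteq> B" using A' B(2) unfolding A_def by auto
      then obtain x y where xy: "x \<in> A" "y \<in> B" "y \<notin> A" "E x y"
        using connected_inD[OF K_modelD(3)[OF assms(1) B(1)]] by metis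
      then have "h x \<in> A'" "h y \<in> B' - A'" unfolding A_def B(2) by auto
      moreover have "E' (h x) (h y)" using E xy sub[OF B(1)] \<open>A \<subseteq> B\<close> by blast
      ultimately show "\<exists>x\<in>A'. \<exists>y\<in>B' - A'. E' x y" by blast
    qed
  next
    fix B' C' assume "B' \<in> (`) h ` \<B>" "C' \<in> (`) h ` \<B>" "B' \<noteq> C'"
    then obtain B C where BC: "B \<in> \<B>" "C \<in> \<B>" "B \<noteq> C" "B' = h ` B" "C' = h ` C" by blast
    have "B \<inter> C = {}" using K_model_disjoint[OF assms(1) BC(1,2)] BC(3) by blast
    then show "B' \<inter> C' = {}"
      using BC(4,5) inj_on_image_Int[OF assms(2) sub[OF BC(1)] sub[OF BC(2)]] by simp
    obtain x y where "x \<in> B" "y \<in> C" "E x y" using K_model_adjacent[OF assms(1) BC(1-3)] .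
    then show "\<exists>x\<in>B'. \<exists>y\<in>C'. E' x y" using BC(4,5) E[of x y] sub[OF BC(1)] sub[OF BC(2)] by blast
  qed
qed

lemma K_model_free_image:
  assumes "K_model_free V E t" "inj_on g V" "simple_graph V E"
  shows "K_model_free (g ` V) (\<lambda>a b. \<exists>u v. a = g u \<and> b = g v \<and> E u v) t"
  unfolding K_model_free_def
proof (intro allI impI notI)
  fix \<B> assume \<B>: "K_model (g ` V) (\<lambda>a b. \<exists>u v. a = g u \<and> b = g v \<and> E u v) \<B>" "card \<B> = t"
  let ?h = "the_inv_into V g"
  have h: "?h (g u) = u" if "u \<in> V" for u using the_inv_into_f_f[OF assms(2) that] .
  have "?h ` g ` V = V" using h by (simp add: image_image)
  have inj: "inj_on ?h (g ` V)" using inj_on_the_inv_into[OF assms(2)] .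
  have E: "E (?h a) (?h b)" if "\<exists>u v. a = g u \<and> b = g v \<and> E u v" for a b
    using that h assms(3) unfolding simple_graph_def by auto
  note * = K_model_image[OF \<B>(1) inj, of E, OF E]
  have "K_model V E ((`) ?h ` \<B>)" using *(1) \<open>?h ` g ` V = V\<close> by simp
  then show False using assms(1) *(2) \<B>(2) unfolding K_model_free_def by simp
qed

lemma simple_graph_Un:
  assumes "simple_graph V E" "simple_graph V' E'"
  shows "simple_graph (V \<union> V') (\<lambda>u v. E u v \<or> E' u v)"
  using assms unfolding simple_graph_def by auto

text \<open>The gadget is renamed so that its clique \<open>xs\<close> becomes \<open>ys\<close> and
  everything else is moved off \<open>V\<close>. The union is then a clique sum along
  \<open>ys\<close>, and a colouring showing \<open>cs\<close> on \<open>ys\<close> would pull back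
  to a colouring of the gadget that \<open>dead\<close> excludes.\<close>

lemma glue_dead:
  assumes G: "list_graph k V E M" and "dead k cs" and ys: "clique_list V E ys" "length ys = length cs"
  shows "\<exists>V' E' M'. list_graph k V' E' M' \<and> V \<subseteq> V' \<and> (\<forall>u v. E u v \<longrightarrow> E' u v) \<and>
           (\<forall>f. colours k E' M' V' f \<longrightarrow> colours k E M V f \<and> map f ys \<noteq> cs)"
proof -
  obtain V2 E2 M2 xs where G2: "list_graph k V2 E2 M2" and xs: "clique_list V2 E2 xs" "length xs = length cs"
    and no: "\<And>f. colours k E2 M2 (V2 - set xs) f \<Longrightarrow> map f xs \<noteq> cs"
    using assms(2) unfolding dead_def by blast
  have sg: "simple_graph V E" and sg2: "simple_graph V2 E2"
    using G G2 unfolding list_graph_def by blast+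
  then have "finite V" unfolding simple_graph_def by blast
  then obtain N where N: "\<And>v. v \<in> V \<Longrightarrow> v < N" using finite_nat_set_iff_bounded by metis
  \<comment> \<open>\<open>N\<close> exceeds every vertex of \<open>V\<close>, so shifting by
    \<open>N\<close> moves the gadget outside its clique away from \<open>V\<close>.\<close>
  define g where "g v = (if v \<in> set xs then the (map_of (zip xs ys) v) else v + N)" for v
  have len: "length xs = length ys" using xs(2) ys(2) by simp
  have dxs: "distinct xs" "set xs \<subseteq> V2" and dys: "distinct ys" "set ys \<subseteq> V"
    using xs(1) ys(1) unfolding clique_list_def by blast+
  have g_nth: "g (xs ! i) = ys ! i" if "i < length xs" for i
    using that dxs len unfolding g_def by (simp add: map_of_zip_nth)
  have gxs: "map g xs = ys" using g_nth len by (intro nth_equalityI) auto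
  have gimg: "set ys = g ` set xs" unfolding gxs[symmetric] by simp
  have g_out: "g v \<notin> V" if "v \<notin> set xs" for v
    using that N[of "v + N"] unfolding g_def by auto
  have inj: "inj_on g V2"
  proof (rule inj_onI)
    fix u v assume uv: "u \<in> V2" "v \<in> V2" "g u = g v"
    have gin: "g w \<in> V" if "w \<in> set xs" for w
      using that gimg dys(2) by blast
    show "u = v"
    proof (cases "u \<in> set xs")
      case True
      then have v: "v \<in> set xs" using gin g_out uv(3) by metis
      obtain i j where "i < length xs" "j < length xs" "u = xs ! i" "v = xs ! j"
        using True v by (metis in_set_conv_nth)
      then show ?thesis using uv(3) g_nth dys(1) len by (simp add: nth_eq_iff_index_eq)
    next
      case False
      then have "v \<notin> set xs" using gin g_out uv(3) by metis
      then show ?thesis using False uv(3) unfolding g_def by simp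
    qed
  qed
  define E3 where "E3 = (\<lambda>a b. \<exists>u v. a = g u \<and> b = g v \<and> E2 u v)"
  have int: "V \<inter> g ` V2 = set ys"
  proof
    show "V \<inter> g ` V2 \<subseteq> set ys" using g_out gimg by blast
    show "set ys \<subseteq> V \<inter> g ` V2" using gimg dxs(2) dys(2) by blast
  qed
  have sg3: "simple_graph (g ` V2) E3"
    unfolding simple_graph_def E3_def
  proof (intro conjI allI impI)
    show "finite (g ` V2)" using sg2 unfolding simple_graph_def by blast
    fix a b assume "\<exists>u v. a = g u \<and> b = g v \<and> E2 u v"
    then obtain u v where uv: "a = g u" "b = g v" "E2 u v" by blast
    then have "u \<in> V2" "v \<in> V2" "E2 v u" using sg2 unfolding simple_graph_def by blast+
    then show "a \<in> g ` V2" "b \<in> g ` V2" "\<exists>u v. b = g u \<and> a = g v \<and> E2 u v" using uv by blast+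
  next
    fix a
    show "\<not> (\<exists>u v. a = g u \<and> a = g v \<and> E2 u v)"
    proof
      assume "\<exists>u v. a = g u \<and> a = g v \<and> E2 u v"
      then obtain u v where uv: "g u = g v" "E2 u v" by auto
      then have "u \<in> V2" "v \<in> V2" using sg2 unfolding simple_graph_def by blast+
      then have "u = v" using inj uv(1) by (meson inj_onD)
      then show False using uv(2) sg2 unfolding simple_graph_def by blast
    qed
  qed
  have free3: "K_model_free (g ` V2) E3 (k + 3)"
    unfolding E3_def using G2 inj sg2 unfolding list_graph_def by (intro K_model_free_image) auto
  have clique: "E a b \<and> E3 a b" if ab: "a \<in> V \<inter> g ` V2" "b \<in> V \<inter> g ` V2" "a \<noteq> b" for a b
  proof
    have "a \<in> set ys" "b \<in> set ys" using ab int by blast+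
    then show "E a b" using ys(1) ab(3) unfolding clique_list_def by blast
    obtain x y where xy: "x \<in> set xs" "y \<in> set xs" "a = g x" "b = g y"
      using \<open>a \<in> set ys\<close> \<open>b \<in> set ys\<close> gimg by blast
    moreover have "x \<noteq> y" using xy(3,4) ab(3) by auto
    ultimately have "E2 x y" using xs(1) unfolding clique_list_def by simp
    then show "E3 a b" unfolding E3_def using xy by blast
  qed
  define V' where "V' = V \<union> g ` V2"
  define E' where "E' = (\<lambda>u v. E u v \<or> E3 u v)"
  \<comment> \<open>Glued vertices keep the lists of \<open>V\<close>. This agrees with
    \<open>dead\<close>, which tests no lists on the clique of the gadget.\<close>
  define M' where "M' a = (if a \<in> V then M a else M2 (the_inv_into V2 g a))" for a
  have M'g: "M' (g v) = M2 v" if "v \<in> V2" "g v \<notin> V" for v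
    unfolding M'_def using that the_inv_into_f_f[OF inj that(1)] by simp
  have "list_graph k V' E' M'"
    unfolding list_graph_def
  proof (intro conjI ballI)
    show "simple_graph V' E'"
      unfolding V'_def E'_def using sg sg3 by (rule simple_graph_Un)
    show "K_model_free V' E' (k + 3)"
      unfolding V'_def E'_def
      using K_model_free_clique_sum[OF sg sg3 _ free3 clique] G unfolding list_graph_def by blast
    fix a assume a: "a \<in> V'"
    have "M' a \<subseteq> Collect even \<and> card (M' a) = 2"
    proof (cases "a \<in> V")
      case True then show ?thesis using G unfolding list_graph_def M'_def by simp
    next
      case False
      then obtain v where "v \<in> V2" "a = g v" using a unfolding V'_def by blast
      then show ?thesis using M'g[of v] False G2 unfolding list_graph_def by simp
    qed
    then show "M' a \<subseteq> Collect even" "card (M' a) = 2" by blast+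
  qed
  moreover have "colours k E M V f \<and> map f ys \<noteq> cs" if f: "colours k E' M' V' f" for f
  proof
    show "colours k E M V f"
      using f unfolding colours_def V'_def E'_def M'_def by (auto split: if_splits)
    have "colours k E2 M2 (V2 - set xs) (f \<circ> g)"
      unfolding colours_def
    proof (intro conjI ballI allI impI)
      fix v assume v: "v \<in> V2 - set xs"
      then have "f (g v) \<in> singles k \<union> M' (g v)" using f unfolding colours_def V'_def by blast
      then show "(f \<circ> g) v \<in> singles k \<union> M2 v" using M'g[of v] g_out[of v] v by simp
    next
      fix u v assume "E2 u v"
      then have "E' (g u) (g v)" unfolding E'_def E3_def by blast
      then show "(f \<circ> g) u \<noteq> (f \<circ> g) v" using f unfolding colours_def by simp
    qed
    from no[OF this] show "map f ys \<noteq> cs" using gxs by (simp flip: map_map)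
  qed
  ultimately show ?thesis
    by (intro exI[of _ V'] exI[of _ E'] exI[of _ M']) (auto simp: V'_def E'_def)
qed

text \<open>Cliques of \<open>V\<close> stay cliques as the graph grows, and colourings restrict to
  the earlier graphs, so earlier prohibitions survive later gluings.\<close>

lemma glue_dead_finite:
  assumes "finite Ks" "list_graph k V E M" "dead k cs"
    and "\<And>ys. ys \<in> Ks \<Longrightarrow> clique_list V E ys \<and> length ys = length cs"
  shows "\<exists>V' E' M'. list_graph k V' E' M' \<and> V \<subseteq> V' \<and> (\<forall>u v. E u v \<longrightarrow> E' u v) \<and>
           (\<forall>f. colours k E' M' V' f \<longrightarrow> colours k E M V f \<and> (\<forall>ys\<in>Ks. map f ys \<noteq> cs))"
  using assms(1,4)
proof (induction Ks)
  case empty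
  show ?case using assms(2) by (intro exI[of _ V] exI[of _ E] exI[of _ M]) simp
next
  case (insert ys Ks)
  then obtain V1 E1 M1 where 1: "list_graph k V1 E1 M1" "V \<subseteq> V1" "\<forall>u v. E u v \<longrightarrow> E1 u v"
      "\<forall>f. colours k E1 M1 V1 f \<longrightarrow> colours k E M V f \<and> (\<forall>ys\<in>Ks. map f ys \<noteq> cs)"
    by (metis insertCI)
  have ys: "clique_list V1 E1 ys" "length ys = length cs"
    using insert.prems[of ys] 1(2,3) unfolding clique_list_def by auto
  obtain V2 E2 M2 where 2: "list_graph k V2 E2 M2" "V1 \<subseteq> V2" "\<forall>u v. E1 u v \<longrightarrow> E2 u v"
      "\<forall>f. colours k E2 M2 V2 f \<longrightarrow> colours k E1 M1 V1 f \<and> map f ys \<noteq> cs"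
    using glue_dead[OF 1(1) assms(3) ys] by metis
  show ?case
  proof (intro exI[of _ V2] exI[of _ E2] exI[of _ M2] conjI allI impI ballI)
    show "list_graph k V2 E2 M2" "V \<subseteq> V2" using 1(2) 2(1,2) by auto
    show "E2 u v" if "E u v" for u v using that 1(3) 2(3) by simp
    fix f assume "colours k E2 M2 V2 f"
    then have f: "colours k E1 M1 V1 f" "map f ys \<noteq> cs" using 2(4) by auto
    then show "colours k E M V f" using 1(4) by simp
    fix zs assume "zs \<in> insert ys Ks"
    then show "map f zs \<noteq> cs" using f 1(4) by auto
  qed
qed

section \<open>More common colours, and a graph without colourings\<close>

text \<open>A new universal vertex that carries the new odd colour removes this colour from all
  other vertices and leaves the old gadget. The order of the excluded clique rises by one together
  with \<open>k\<close>.\<close>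

lemma dead_Suc:
  assumes "dead k cs"
  shows "dead (Suc k) ((2 * k + 1) # cs)"
proof -
  obtain V E M xs where G: "list_graph k V E M" and xs: "clique_list V E xs" "length xs = length cs"
    and no: "\<And>f. colours k E M (V - set xs) f \<Longrightarrow> map f xs \<noteq> cs"
    using assms unfolding dead_def by blast
  have sg: "simple_graph V E" using G unfolding list_graph_def by blast
  then have "finite V" unfolding simple_graph_def by blast
  then obtain w where w: "w \<notin> V" using ex_new_if_finite[OF infinite_UNIV_nat] by blast
  define E' where "E' u v \<longleftrightarrow> E u v \<or> (u = w \<and> v \<in> V) \<or> (v = w \<and> u \<in> V)" for u v
  \<comment> \<open>\<open>{0,2}\<close> is a default value: \<open>list_graph\<close> asks for two
    even colours at \<open>w\<close>, which belongs to the clique of the new gadget.\<close>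
  define M' where "M' = M(w := {0,2})"
  have "list_graph (Suc k) (insert w V) E' M'"
    unfolding list_graph_def
  proof (intro conjI ballI)
    show "simple_graph (insert w V) E'"
      using sg w unfolding simple_graph_def E'_def by auto
    have "K_model_free (insert w V) E' (Suc (k + 3))"
      using G w unfolding list_graph_def
      by (intro K_model_free_universal_vertex[of V E]) (auto simp: E'_def)
    then show "K_model_free (insert w V) E' (Suc k + 3)" by simp
    fix v assume "v \<in> insert w V"
    then show "M' v \<subseteq> Collect even" "card (M' v) = 2"
      using G unfolding list_graph_def M'_def by auto
  qed
  moreover have "clique_list (insert w V) E' (w # xs)"
    using xs(1) w unfolding clique_list_def E'_def by auto
  moreover have "map f (w # xs) \<noteq> (2 * k + 1) # cs"
    if f: "colours (Suc k) E' M' (insert w V - set (w # xs)) f" for f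
  proof
    assume eq: "map f (w # xs) = (2 * k + 1) # cs"
    have "colours k E M (V - set xs) f"
      unfolding colours_def
    proof (intro conjI ballI allI impI)
      fix v assume v: "v \<in> V - set xs"
      then have "v \<in> insert w V - set (w # xs)" using w by auto
      then have "f v \<in> singles (Suc k) \<union> M' v" using f unfolding colours_def by blast
      moreover have "f w \<noteq> f v" using f v unfolding colours_def E'_def by blast
      moreover have "M' v = M v" unfolding M'_def using v w by auto
      ultimately show "f v \<in> singles k \<union> M v"
        using eq unfolding singles_def by (auto simp: lessThan_Suc)
    next
      fix u v assume "E u v"
      then show "f u \<noteq> f v" using f unfolding colours_def E'_def by blast
    qed
    then show False using no eq by auto
  qed
  ultimately show ?thesis
    unfolding dead_def using xs(2)
    by (intro exI[of _ "insert w V"] exI[of _ E'] exI[of _ M'] exI[of _ "w # xs"]) simp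
qed

lemma card_singles: "card (singles k) = k" "finite (singles k)" "singles k \<inter> Collect even = {}"
  unfolding singles_def by (auto simp: card_image inj_on_def)

text \<open>The start is a complete graph on \<open>k + 2\<close> vertices, all with the same
  \<open>k + 2\<close> colours. A colouring of it is a bijection onto these colours, so
  \<open>cs\<close> appears on some tuple of distinct vertices; a gadget sits on every such
  tuple.\<close>

lemma uncolourable_if_dead:
  assumes "dead k cs" "distinct cs" "set cs \<subseteq> singles k \<union> {0,2}"
  shows "\<exists>V E M. list_graph k V E M \<and> V \<noteq> {} \<and> (\<forall>f. \<not> colours k E M V f)"
proof -
  define V where "V = {..<k + 2}"
  define E where "E u v \<longleftrightarrow> u \<in> V \<and> v \<in> V \<and> u \<noteq> v" for u v
  define M where "M = (\<lambda>v::nat. {0,2::nat})"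
  define Ks where "Ks = {ys. set ys \<subseteq> V \<and> length ys = length cs \<and> distinct ys}"
  have G: "list_graph k V E M"
    unfolding list_graph_def
  proof (intro conjI ballI)
    show "simple_graph V E" unfolding simple_graph_def E_def V_def by auto
    show "K_model_free V E (k + 3)" by (rule K_model_free_if_card_less) (simp_all add: V_def)
  qed (auto simp: M_def)
  have "finite Ks"
    by (rule finite_subset[OF _ finite_lists_length_eq[of V "length cs"]]) (auto simp: Ks_def V_def)
  moreover have "clique_list V E ys \<and> length ys = length cs" if "ys \<in> Ks" for ys
    using that unfolding Ks_def clique_list_def E_def by auto
  ultimately obtain V' E' M' where G': "list_graph k V' E' M'" "V \<subseteq> V'"
      "\<forall>f. colours k E' M' V' f \<longrightarrow> colours k E M V f \<and> (\<forall>ys\<in>Ks. map f ys \<noteq> cs)"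
    using glue_dead_finite[OF _ G assms(1), of Ks] by metis
  have "\<not> colours k E' M' V' f" for f
  proof
    assume "colours k E' M' V' f"
    then have f: "colours k E M V f" "\<forall>ys\<in>Ks. map f ys \<noteq> cs" using G'(3) by auto
    have inj: "inj_on f V" using f(1) unfolding colours_def E_def by (meson inj_onI)
    have "f ` V \<subseteq> singles k \<union> {0,2}" using f(1) unfolding colours_def M_def by (simp add: image_subset_iff)
    moreover have "card (singles k \<union> {0,2}) = k + 2"
      using card_singles[of k] by (subst card_Un_disjoint) auto
    ultimately have img: "f ` V = singles k \<union> {0,2}"
      using card_image[OF inj] card_singles(2)[of k] by (intro card_subset_eq) (auto simp: V_def)
    \<comment> \<open>Inverting the bijection \<open>f\<close> gives the tuple on which the dead
      sequence appears.\<close>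
    define ys where "ys = map (the_inv_into V f) cs"
    have cs: "c \<in> f ` V" if "c \<in> set cs" for c using that assms(3) img by blast
    have map: "map f ys = cs"
      unfolding ys_def using cs f_the_inv_into_f[OF inj] by (simp add: map_idI)
    have "set ys \<subseteq> V" unfolding ys_def using cs the_inv_into_into[OF inj] by auto
    moreover have "distinct ys"
      using map assms(2) by (auto simp: distinct_map)
    moreover have "length ys = length cs" unfolding ys_def by simp
    ultimately show False using f(2) map unfolding Ks_def by blast
  qed
  then show ?thesis using G'(1,2) unfolding V_def by (metis empty_iff lessThan_iff subsetD zero_less_Suc add_2_eq_Suc')
qed

lemma dead_pattern_exists:
  assumes "dead 2 cs0" "distinct cs0" "set cs0 \<subseteq> singles 2 \<union> {0,2}" "k \<ge> 2"
  shows "\<exists>cs. dead k cs \<and> distinct cs \<and> set cs \<subseteq> singles k \<union> {0,2}"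
  using assms(4)
proof (induction k rule: dec_induct)
  case base
  show ?case using assms(1-3) by blast
next
  case (step k)
  then obtain cs where cs: "dead k cs" "distinct cs" "set cs \<subseteq> singles k \<union> {0,2}" by blast
  have "2 * k + 1 \<notin> singles k \<union> {0,2}" "singles (Suc k) = insert (2 * k + 1) (singles k)"
    unfolding singles_def by (auto simp: lessThan_Suc)
  then show ?case using cs dead_Suc[OF cs(1)]
    by (intro exI[of _ "(2 * k + 1) # cs"]) auto
qed

text \<open>The colour classes are the singletons of the \<open>k\<close> common odd colours and,
  last, the set of all even colours in use.\<close>

lemma not_lambda_choosable_if_uncolourable:
  assumes "list_graph k V E M" "V \<noteq> {}" "\<And>f. \<not> colours k E M V f"
  shows "\<not> lambda_choosable V E (mset (replicate k 1 @ [2]))"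
proof
  assume ch: "lambda_choosable V E (mset (replicate k 1 @ [2]))"
  define L where "L v = singles k \<union> M v" for v
  define Cs where "Cs = map (\<lambda>i. {2 * i + 1}) [0..<k] @ [\<Union>v\<in>V. M v]"
  have M: "M v \<subseteq> Collect even" "card (M v) = 2" if "v \<in> V" for v
    using assms(1) that unfolding list_graph_def by blast+
  have sg: "simple_graph V E" using assms(1) unfolding list_graph_def by blast
  have nth: "Cs ! i = (if i < k then {2 * i + 1} else \<Union>v\<in>V. M v)" if "i < Suc k" for i
    using that unfolding Cs_def by (auto simp: nth_append)
  have "lambda_list_assignment V (mset (replicate k 1 @ [2])) L"
    unfolding lambda_list_assignment_def
  proof (intro exI[of _ "replicate k 1 @ [2]"] exI[of _ Cs] conjI allI impI ballI)
    show len: "length Cs = length (replicate k 1 @ [2])" unfolding Cs_def by simp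
    have odd: "2 * i + 1 \<notin> (\<Union>v\<in>V. M v)" for i using M(1) by fastforce
    show "Cs ! i \<inter> Cs ! j = {}" if "i < length Cs" "j < length Cs" "i \<noteq> j" for i j
      using that len odd by (auto simp: nth)
    have "\<Union>(set Cs) = singles k \<union> (\<Union>v\<in>V. M v)" unfolding Cs_def singles_def by auto
    \<comment> \<open>The common colours occur in the union of the lists because there is at least
      one vertex.\<close>
    then show "\<Union>(set Cs) = (\<Union>v\<in>V. L v)" unfolding L_def using assms(2) by auto
    fix i v assume i: "i < length (replicate k 1 @ [2])" and v: "v \<in> V"
    show "(replicate k 1 @ [2]) ! i \<le> card (L v \<inter> Cs ! i)"
    proof (cases "i < k")
      case True
      then have "L v \<inter> Cs ! i = {2 * i + 1}" by (auto simp: nth L_def singles_def)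
      then show ?thesis using True by (simp add: nth_append)
    next
      case False
      then have "i = k" using i by simp
      have "L v \<inter> Cs ! i = M v"
      proof -
        have "singles k \<inter> (\<Union>v\<in>V. M v) = {}" using card_singles(3)[of k] M(1) by blast
        then show ?thesis using v \<open>i = k\<close> by (auto simp: nth L_def)
      qed
      then show ?thesis using M(2)[OF v] \<open>i = k\<close> by (simp add: nth_append)
    qed
  qed simp
  then obtain f where f: "L_colouring V E L f" using ch unfolding lambda_choosable_def by blast
  have "colours k E M V f"
    using f sg unfolding L_colouring_def colours_def L_def simple_graph_def by auto
  then show False using assms(3) by blast
qed

section \<open>A planar gadget\<close>

text \<open>Found by computer search. Vertices 10, 11, 12 and 13, 14, 15 complete the triangles 1, 3, 8 and 2, 4, 6
  to octahedra, which forbid three distinct even colours there. The faces are listed along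
  a Hamiltonian path of the dual graph, which makes its connectivity evident.\<close>

definition gadget_faces :: "nat set list" where
  "gadget_faces = [{0,1,2}, {0,1,3}, {0,3,6}, {0,2,6}, {2,6,15}, {2,13,15}, {2,4,13}, {2,4,5}, {1,2,5},
     {1,5,9}, {4,5,9}, {4,7,9}, {7,8,9}, {1,8,9}, {1,8,12}, {1,10,12}, {1,3,10}, {3,10,11}, {10,11,12},
     {8,11,12}, {3,8,11}, {3,7,8}, {3,6,7}, {4,6,7}, {4,6,14}, {4,13,14}, {13,14,15}, {6,14,15}]"

section \<open>Certifying the triangulation by computation\<close>

text \<open>The hypotheses are executable on a concrete list of faces. Consecutive faces share an
  edge, so a set of faces closed under crossing edges contains all of the path or nothing.\<close>

lemma triangulated_sphere_path:
  assumes "distinct fs" "fs \<noteq> []" "\<forall>f\<in>set fs. card f = 3"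
    and "\<forall>i<length fs - 1. card (fs ! i \<inter> fs ! Suc i) = 2"
    and "\<forall>f\<in>set fs. \<forall>a\<in>f. \<forall>b\<in>f. a \<noteq> b \<longrightarrow> length (filter (\<lambda>g. a \<in> g \<and> b \<in> g) fs) = 2"
    and "length fs + 4 = 2 * card (\<Union>(set fs))"
  shows "triangulated_sphere (set fs)"
  unfolding triangulated_sphere_def
proof (intro conjI allI impI ballI)
  show "card (set fs) + 4 = 2 * card (\<Union> (set fs))" using assms(1,6) by (simp add: distinct_card)
  show "card f = 3" if "f \<in> set fs" for f using assms(3) that by blast
next
  fix f e assume f: "f \<in> set fs" "e \<subseteq> f" "card e = 2"
  then obtain a b where ab: "e = {a,b}" "a \<noteq> b" unfolding card_2_iff by blast
  have "{g \<in> set fs. e \<subseteq> g} = set (filter (\<lambda>g. a \<in> g \<and> b \<in> g) fs)" using ab(1) by auto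
  also have "card \<dots> = length (filter (\<lambda>g. a \<in> g \<and> b \<in> g) fs)"
    using assms(1) by (intro distinct_card) simp
  also have "\<dots> = 2" using assms(5) f ab by blast
  finally show "card {g \<in> set fs. e \<subseteq> g} = 2" .
next
  fix R assume R: "R \<subseteq> set fs" "R \<noteq> {}" "\<forall>f\<in>R. \<forall>g\<in>set fs. card (f \<inter> g) = 2 \<longrightarrow> g \<in> R"
  have step: "fs ! i \<in> R \<longleftrightarrow> fs ! Suc i \<in> R" if "Suc i < length fs" for i
  proof -
    have "card (fs ! i \<inter> fs ! Suc i) = 2" using assms(4) that by simp
    moreover from this have "card (fs ! Suc i \<inter> fs ! i) = 2" by (simp add: Int_commute)
    moreover have "fs ! i \<in> set fs" "fs ! Suc i \<in> set fs" using that by simp_all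
    ultimately show ?thesis using R(3) by meson
  qed
  have all: "fs ! i \<in> R \<longleftrightarrow> fs ! 0 \<in> R" if "i < length fs" for i
    using that
  proof (induction i)
    case (Suc i) then show ?case using step[of i] by simp
  qed simp
  obtain f where "f \<in> R" using R(2) by blast
  then obtain i where "i < length fs" "fs ! i \<in> R" using R(1) by (metis in_set_conv_nth subsetD)
  then have "fs ! j \<in> R" if "j < length fs" for j using all that by blast
  then show "R = set fs" using R(1) by (auto simp: in_set_conv_nth)
qed (use assms(2) in auto)

lemma gadget_sphere: "triangulated_sphere (set gadget_faces)"
proof (rule triangulated_sphere_path)
  show "distinct gadget_faces" by code_simp
  show "gadget_faces \<noteq> []" by code_simp
  show "\<forall>f\<in>set gadget_faces. card f = 3" by code_simp
  show "\<forall>i<length gadget_faces - 1. card (gadget_faces ! i \<inter> gadget_faces ! Suc i) = 2" by code_simp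
  show "\<forall>f\<in>set gadget_faces. \<forall>a\<in>f. \<forall>b\<in>f. a \<noteq> b \<longrightarrow>
      length (filter (\<lambda>g. a \<in> g \<and> b \<in> g) gadget_faces) = 2" by code_simp
  show "length gadget_faces + 4 = 2 * card (\<Union>(set gadget_faces))" by code_simp
qed


section \<open>The colouring of the outer triangle that does not extend\<close>

definition gadget_lists :: "nat set list" where
  "gadget_lists = [{0,2}, {0,2}, {0,2}, {0,4}, {2,6}, {0,2}, {2,4}, {4,6}, {0,6}, {0,6},
     {0,4}, {4,6}, {0,6}, {2,6}, {4,6}, {2,4}]"

text \<open>The common colours are 1 and 3. The colours on the outer triangle leave only 3 and 4 for
  the adjacent vertices 3 and 6, and each of the two ways to distribute them is refuted by forced
  colours, ending at vertex 8.\<close>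

lemma dead_gadget: "dead 2 [1,0,2]"
  unfolding dead_def
proof (intro exI conjI allI impI)
  let ?F = "set gadget_faces" and ?M = "(!) gadget_lists"
  have V: "\<Union>?F = {..<16}" by code_simp
  show "list_graph 2 (\<Union>?F) (face_adj ?F) ?M"
    unfolding list_graph_def
  proof (intro conjI ballI)
    show "simple_graph (\<Union>?F) (face_adj ?F)"
      using triangulated_sphere_finite[OF gadget_sphere] by (intro simple_graph_face_adj) auto
    show "K_model_free (\<Union>?F) (face_adj ?F) (2 + 3)"
      using triangulated_sphere_K5_model_free[OF gadget_sphere] by simp
    have "\<forall>v<16. (\<forall>c\<in>gadget_lists ! v. even c) \<and> card (gadget_lists ! v) = 2" by code_simp
    then show "?M v \<subseteq> Collect even" "card (?M v) = 2" if "v \<in> \<Union>?F" for v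
      using that unfolding V by auto
  qed
  show "clique_list (\<Union>?F) (face_adj ?F) [0,1,2]"
    unfolding clique_list_def V face_adj_def by (auto simp: gadget_faces_def)
  show "length [0,1,2::nat] = length [1,0,2::nat]" by simp
  fix f :: "nat \<Rightarrow> nat"
  assume f: "colours 2 (face_adj ?F) ?M (\<Union>?F - set [0,1,2]) f"
  show "map f [0,1,2] \<noteq> [1,0,2]"
  proof
    assume "map f [0,1,2] = [1,0,2]"
    then have f0: "f 0 = 1" "f 1 = 0" "f 2 = 2" by simp_all
    have proper: "f a \<noteq> f b" if "fc \<in> ?F" "a \<in> fc" "b \<in> fc" "a \<noteq> b" for fc a b
      using f that unfolding colours_def face_adj_def by blast
    have edges: "\<forall>fc\<in>?F. \<forall>a\<in>fc. \<forall>b\<in>fc. a < b \<longrightarrow> f a \<noteq> f b" using proper by blast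
    have lists: "\<forall>v\<in>{3..<16}. f v \<in> {1,3} \<union> gadget_lists ! v"
    proof
      fix v :: nat assume "v \<in> {3..<16}"
      then have "v \<in> \<Union>?F - set [0,1,2]" unfolding V by auto
      then have "f v \<in> singles 2 \<union> gadget_lists ! v" using f unfolding colours_def by blast
      moreover have "singles 2 = {1,3}" by code_simp
      ultimately show "f v \<in> {1,3} \<union> gadget_lists ! v" by simp
    qed
    have l: "f 3 \<in> {1,3,0,4}" "f 4 \<in> {1,3,2,6}" "f 5 \<in> {1,3,0,2}" "f 6 \<in> {1,3,2,4}"
       "f 7 \<in> {1,3,4,6}" "f 8 \<in> {1,3,0,6}" "f 9 \<in> {1,3,0,6}" "f 10 \<in> {1,3,0,4}" "f 11 \<in> {1,3,4,6}"
       "f 12 \<in> {1,3,0,6}" "f 13 \<in> {1,3,2,6}" "f 14 \<in> {1,3,4,6}" "f 15 \<in> {1,3,2,4}"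
      using lists by (auto simp: gadget_lists_def)
    note e = edges[unfolded gadget_faces_def, simplified]
    \<comment> \<open>The triangle 1, 3, 8 would carry 0, 4, 6, and each of 10, 11, 12 sees both of
      its even colours. That triangle would have to be coloured from 1 and 3 alone; the octahedron
      on 2, 4, 6 works in the same way.\<close>
    have octahedron1: "\<not> (f 3 = 4 \<and> f 8 = 6)"
    proof
      assume "f 3 = 4 \<and> f 8 = 6"
      then have "f 10 \<in> {1,3}" "f 11 \<in> {1,3}" "f 12 \<in> {1,3}" using l(8-10) e f0 by auto
      then show False using e by auto
    qed
    have octahedron2: "\<not> (f 4 = 6 \<and> f 6 = 4)"
    proof
      assume "f 4 = 6 \<and> f 6 = 4"
      then have "f 13 \<in> {1,3}" "f 14 \<in> {1,3}" "f 15 \<in> {1,3}" using l(11-13) e f0 by auto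
      then show False using e by auto
    qed
    have "f 5 \<in> {1,3}" using l(3) e f0 by auto
    have "f 3 \<in> {3,4}" "f 6 \<in> {3,4}" "f 3 \<noteq> f 6" using l(1,4) e f0 by auto
    then consider "f 3 = 3" "f 6 = 4" | "f 3 = 4" "f 6 = 3" by auto
    then show False
    proof cases
      case 1
      have "f 4 \<in> {1,3}" using l(2) e f0 1 octahedron2 by auto
      \<comment> \<open>The adjacent vertices 4 and 5 use up both common colours, and vertex 1 takes
        0.\<close>
      have "f 9 = 6" using l(7) \<open>f 4 \<in> {1,3}\<close> \<open>f 5 \<in> {1,3}\<close> e f0 by auto
      have "f 7 = 1" using l(5) \<open>f 9 = 6\<close> 1 e by auto
      \<comment> \<open>Vertex 8 sees all of 0, 1, 3 and 6 on its neighbours 1, 7, 3 and 9.\<close>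
      show False using l(6) \<open>f 7 = 1\<close> \<open>f 9 = 6\<close> 1 e f0 by auto
    next
      case 2
      have "f 4 \<in> {1,6}" using l(2) e f0 2 by auto
      have "f 7 \<in> {1,6}" using l(5) e f0 2 by auto
      \<comment> \<open>The adjacent vertices 4 and 7 carry 1 and 6 in some order, and vertex 1
        takes 0.\<close>
      have "f 9 = 3" using l(7) \<open>f 4 \<in> {1,6}\<close> \<open>f 7 \<in> {1,6}\<close> e f0 by auto
      have "f 5 = 1" using \<open>f 5 \<in> {1,3}\<close> \<open>f 9 = 3\<close> e by auto
      have "f 7 = 1" using \<open>f 4 \<in> {1,6}\<close> \<open>f 7 \<in> {1,6}\<close> \<open>f 5 = 1\<close> e by auto
      \<comment> \<open>Only colour 6 is left at vertex 8, which the octahedron on 1, 3, 8 excludes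
        as vertex 3 has colour 4.\<close>
      show False using l(6) octahedron1 \<open>f 7 = 1\<close> \<open>f 9 = 3\<close> 2 e f0 by auto
    qed
  qed
qed

theorem theorem1:
  fixes t :: nat
  assumes "t \<ge> 5"
  shows "\<exists>(V :: nat set) E. simple_graph V E \<and> K_minor_free V E t \<and>
           \<not> lambda_choosable V E (mset (replicate (t - 3) 1 @ [2]))"
proof -
  have "set [1,0,2] \<subseteq> singles 2 \<union> {0,2}" unfolding singles_def by auto
  moreover have "2 \<le> t - 3" "distinct [1,0,2::nat]" using assms by simp_all
  ultimately obtain cs where "dead (t - 3) cs" "distinct cs" "set cs \<subseteq> singles (t - 3) \<union> {0,2}"
    using dead_pattern_exists[OF dead_gadget, of "t - 3"] by blast
  then obtain V E M where G: "list_graph (t - 3) V E M" "V \<noteq> {}" "\<forall>f. \<not> colours (t - 3) E M V f"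
    using uncolourable_if_dead by metis
  \<comment> \<open>The subtraction is not truncated since \<open>t \<ge> 5\<close>, so
    \<open>t - 3 + 3\<close> is \<open>t\<close>.\<close>
  have "simple_graph V E" "K_model_free V E t"
    using G(1) assms unfolding list_graph_def by simp_all
  moreover from this have "K_minor_free V E t" by (rule K_minor_free_if_K_model_free)
  moreover have "\<not> lambda_choosable V E (mset (replicate (t - 3) 1 @ [2]))"
    using not_lambda_choosable_if_uncolourable[OF G(1,2)] G(3) by blast
  ultimately show ?thesis by blast
qed

end
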